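(* Let $\Delta\ge 3$, $c\in[0,\Delta-2]$ and $\kappa=\Delta+c$. There exists a forest of maximum degree at most $\Delta$ on $n$ vertices together with a proper $\kappa$-edge-coloring of it, and an infinite (fully dynamic) update sequence from this state, such that the amortized recourse of {\textsc{Greedy}} from this state onward is $\Omega(\log_\Delta n)$. Moreover, there exists $n_1=n_1(\Delta,c)$ such that for every $n\ge n_1$ this bad state can be reached by {\textsc{Greedy}} from the empty forest by an update sequence.
   Context: A dynamic forest on a fixed vertex set of $n$ vertices undergoes updates, each either the insertion of an edge joining two distinct trees or the deletion of an existing edge (fully dynamic model); the maximum degree always stays at most $\Delta$. An algorithm must maintain a proper edge coloring with palette $[\kappa]$. The recourse of an update is the number of previously colored edges whose color is changed (coloring the newly inserted edge does not count); amortized recourse is total recourse divided by number of updates. {\textsc{Greedy}} is the deterministic algorithm that, upon insertion of an edge $e$, determines a smallest set $H$ of existing edges that can be recolored so that $e$ can receive a color and recolors $H$ and $e$ accordingly (ties broken by an arbitrary deterministic tie-breaking rule; the claim holds for every such rule), and upon a deletion keeps the coloring unchanged. *)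

theory Defs
  imports Complex_Main "HOL-Library.Extended_Real"
begin

text \<open>
  The vertex set is \<open>{..<n}\<close> and an undirected edge is a two-element set of vertices.
  A state of the algorithm is a coloring, a partial map whose domain is exactly the edge set of
  the current forest.  Hence a state carries no information beyond the forest and the colors
  of its edges.
\<close>

type_synonym edge = "nat set"
type_synonym coloring = "edge \<rightharpoonup> nat"

definition possible_edges :: "nat \<Rightarrow> edge set" where
  "possible_edges n = {e. e \<subseteq> {..<n} \<and> card e = 2}"

definition degree :: "edge set \<Rightarrow> nat \<Rightarrow> nat" where
  "degree E v = card {e \<in> E. v \<in> e}"

definition max_degree_le :: "nat \<Rightarrow> nat \<Rightarrow> edge set \<Rightarrow> bool" where
  "max_degree_le n \<Delta> E \<longleftrightarrow> (\<forall>v<n. degree E v \<le> \<Delta>)"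

definition same_tree :: "edge set \<Rightarrow> nat \<Rightarrow> nat \<Rightarrow> bool" where
  "same_tree E u v \<longleftrightarrow> (u, v) \<in> {(x, y). {x, y} \<in> E}\<^sup>*"

definition is_cycle :: "edge set \<Rightarrow> nat list \<Rightarrow> bool" where
  "is_cycle E vs \<longleftrightarrow> length vs \<ge> 3 \<and> distinct vs \<and>
     (\<forall>i<length vs. {vs ! i, vs ! (Suc i mod length vs)} \<in> E)"

definition is_forest :: "nat \<Rightarrow> edge set \<Rightarrow> bool" where
  "is_forest n E \<longleftrightarrow> E \<subseteq> possible_edges n \<and> (\<nexists>vs. is_cycle E vs)"

definition proper_coloring :: "nat \<Rightarrow> coloring \<Rightarrow> bool" where
  "proper_coloring \<kappa> \<chi> \<longleftrightarrow> ran \<chi> \<subseteq> {1..\<kappa>} \<and>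
     (\<forall>e\<in>dom \<chi>. \<forall>f\<in>dom \<chi>. e \<noteq> f \<and> e \<inter> f \<noteq> {} \<longrightarrow> \<chi> e \<noteq> \<chi> f)"

definition valid_state :: "nat \<Rightarrow> nat \<Rightarrow> nat \<Rightarrow> coloring \<Rightarrow> bool" where
  "valid_state n \<Delta> \<kappa> \<chi> \<longleftrightarrow>
     is_forest n (dom \<chi>) \<and> max_degree_le n \<Delta> (dom \<chi>) \<and> proper_coloring \<kappa> \<chi>"

datatype update = Ins edge | Del edge

fun legal :: "nat \<Rightarrow> nat \<Rightarrow> edge set \<Rightarrow> update \<Rightarrow> bool" where
  "legal n \<Delta> E (Ins e) \<longleftrightarrow>
     (\<exists>u<n. \<exists>v<n. e = {u, v} \<and> \<not> same_tree E u v) \<and> max_degree_le n \<Delta> (insert e E)"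
| "legal n \<Delta> E (Del e) \<longleftrightarrow> e \<in> E"

text \<open>
  \<open>recolors_to \<kappa> \<chi> e H \<chi>'\<close>: after the insertion of \<open>e\<close>, the proper coloring \<open>\<chi>'\<close> of the new
  forest is obtained from \<open>\<chi>\<close> by recoloring edges of \<open>H\<close> only and coloring \<open>e\<close>.
\<close>

definition recolors_to :: "nat \<Rightarrow> coloring \<Rightarrow> edge \<Rightarrow> edge set \<Rightarrow> coloring \<Rightarrow> bool" where
  "recolors_to \<kappa> \<chi> e H \<chi>' \<longleftrightarrow>
     dom \<chi>' = insert e (dom \<chi>) \<and> proper_coloring \<kappa> \<chi>' \<and> (\<forall>f\<in>dom \<chi> - H. \<chi>' f = \<chi> f)"

definition can_recolor :: "nat \<Rightarrow> coloring \<Rightarrow> edge \<Rightarrow> edge set \<Rightarrow> bool" where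
  "can_recolor \<kappa> \<chi> e H \<longleftrightarrow> H \<subseteq> dom \<chi> \<and> (\<exists>\<chi>'. recolors_to \<kappa> \<chi> e H \<chi>')"

definition greedy_outcome :: "nat \<Rightarrow> coloring \<Rightarrow> edge \<Rightarrow> coloring \<Rightarrow> bool" where
  "greedy_outcome \<kappa> \<chi> e \<chi>' \<longleftrightarrow>
     (\<exists>H. is_arg_min card (can_recolor \<kappa> \<chi> e) H \<and> recolors_to \<kappa> \<chi> e H \<chi>')"

text \<open>
  A deterministic tie-breaking rule is a function \<open>A\<close> of the current state and the inserted
  edge that selects one of the greedy outcomes; it resolves both the choice of \<open>H\<close> and the
  choice of the new colors.  It is constrained only where the algorithm can be called.
\<close>

definition greedy_rule :: "nat \<Rightarrow> nat \<Rightarrow> nat \<Rightarrow> (coloring \<Rightarrow> edge \<Rightarrow> coloring) \<Rightarrow> bool" where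
  "greedy_rule n \<Delta> \<kappa> A \<longleftrightarrow>
     (\<forall>\<chi> e. valid_state n \<Delta> \<kappa> \<chi> \<and> legal n \<Delta> (dom \<chi>) (Ins e) \<longrightarrow>
        greedy_outcome \<kappa> \<chi> e (A \<chi> e))"

fun step :: "(coloring \<Rightarrow> edge \<Rightarrow> coloring) \<Rightarrow> coloring \<Rightarrow> update \<Rightarrow> coloring" where
  "step A \<chi> (Ins e) = A \<chi> e"
| "step A \<chi> (Del e) = \<chi>(e := None)"

fun run :: "(coloring \<Rightarrow> edge \<Rightarrow> coloring) \<Rightarrow> coloring \<Rightarrow> (nat \<Rightarrow> update) \<Rightarrow> nat \<Rightarrow> coloring" where
  "run A \<chi> \<sigma> 0 = \<chi>"
| "run A \<chi> \<sigma> (Suc t) = step A (run A \<chi> \<sigma> t) (\<sigma> t)"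

definition legal_sequence ::
  "nat \<Rightarrow> nat \<Rightarrow> (coloring \<Rightarrow> edge \<Rightarrow> coloring) \<Rightarrow> coloring \<Rightarrow> (nat \<Rightarrow> update) \<Rightarrow> bool" where
  "legal_sequence n \<Delta> A \<chi> \<sigma> \<longleftrightarrow> (\<forall>t. legal n \<Delta> (dom (run A \<chi> \<sigma> t)) (\<sigma> t))"

definition reachable ::
  "nat \<Rightarrow> nat \<Rightarrow> (coloring \<Rightarrow> edge \<Rightarrow> coloring) \<Rightarrow> coloring \<Rightarrow> bool" where
  "reachable n \<Delta> A \<chi> \<longleftrightarrow>
     (\<exists>\<sigma> T. (\<forall>t<T. legal n \<Delta> (dom (run A Map.empty \<sigma> t)) (\<sigma> t)) \<and> run A Map.empty \<sigma> T = \<chi>)"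

definition recourse :: "coloring \<Rightarrow> coloring \<Rightarrow> nat" where
  "recourse \<chi> \<chi>' = card {f \<in> dom \<chi> \<inter> dom \<chi>'. \<chi>' f \<noteq> \<chi> f}"

definition total_recourse ::
  "(coloring \<Rightarrow> edge \<Rightarrow> coloring) \<Rightarrow> coloring \<Rightarrow> (nat \<Rightarrow> update) \<Rightarrow> nat \<Rightarrow> nat" where
  "total_recourse A \<chi> \<sigma> T = (\<Sum>t<T. recourse (run A \<chi> \<sigma> t) (run A \<chi> \<sigma> (Suc t)))"

text \<open>
  For an infinite update sequence, total recourse divided by the number of updates is read as
  the lower limit of this ratio over the prefixes of the sequence.
\<close>

definition amortized_recourse ::
  "(coloring \<Rightarrow> edge \<Rightarrow> coloring) \<Rightarrow> coloring \<Rightarrow> (nat \<Rightarrow> update) \<Rightarrow> ereal" where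
  "amortized_recourse A \<chi> \<sigma> = liminf (\<lambda>T. ereal (real (total_recourse A \<chi> \<sigma> T) / real T))"

end

theory Submission
  imports Defs
begin

text \<open>
  Lower bound.  Take a path \<open>u\<^sub>0, \<dots>, u\<^sub>L\<close> whose edges alternate between two colors, and hang deep trees
  on its vertices.  In these trees the colors of the child edges of every vertex contain all colors
  missing among the child edges of its parent; hence changing a color into one that is used further
  down propagates to a leaf and costs more than \<open>L\<close>.  So all edges off the path are rigid, and an
  edge inserted at \<open>u\<^sub>0\<close> whose other end is the root of such a tree is forced to take the color of the
  first path edge, which flips the entire path.  After deleting that edge, an insertion at \<open>u\<^sub>L\<close>
  flips the path back, for every tie-breaking rule.  A side edge may still
  take one of the two path colors; which one is chosen according to the parity of its position, and
  this choice makes both flips expensive even for \<open>c = \<Delta> - 2\<close>.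

  Reachability.  Every vertex can be given any set of colors.  Prepare many vertices that see a set
  \<open>X\<close>, fill them up to degree \<open>\<Delta> - 1\<close>, and use the pigeonhole principle to get \<open>c + 1\<close> of them with the
  same color set \<open>X'\<close>; joining these to one fresh vertex uses up all the colors outside \<open>X'\<close>, so one
  of them sees any desired additional color.  With such vertices as temporary neighbors, a new
  pendant edge can be forced to take a prescribed color, and a forest is built edge by edge.
\<close>

section \<open>Legal updates and valid states\<close>

text \<open>The tie-breaking rule is an adversary in both halves. In the lower bound it is disarmed
  by uniqueness: flipping the path shows that \<open>L\<close> changes suffice, rigidity shows that
  exactly these \<open>L\<close> changes are unavoidable, so nothing is left to choose. For
  reachability, edges are inserted only where a color is free at both ends; then nothing is
  recolored, the rule decides only the color of the new edge, and deletions remove whatever was not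
  wanted.

  The color sets in the trees have \<open>\<Delta> - 1\<close> elements, one place being kept for
  the parent edge. The complement of such a set has \<open>c + 1\<close> colors and fits into the
  set one level below exactly when \<open>c \<le> \<Delta> - 2\<close>. The logarithm arises because
  a tree of depth \<open>d\<close> has up to \<open>\<Delta> ^ d\<close> vertices but guarantees
  only \<open>d\<close> changes, those along one chain towards a leaf; protecting a path of
  \<open>L\<close> edges takes \<open>L + 2\<close> trees of depth about \<open>L\<close>.

  The bad state is built without reference to the rule and occupies at most a third of the vertices.
  The scratch space for reaching it depends only on \<open>\<Delta>\<close> and \<open>c\<close>, so
  it fits into the rest for large \<open>n\<close>.\<close>

definition cols :: "coloring \<Rightarrow> nat \<Rightarrow> nat set" where
  "cols \<chi> v = {a. \<exists>e. \<chi> e = Some a \<and> v \<in> e}"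

definition isolated :: "nat \<Rightarrow> coloring \<Rightarrow> nat set" where
  "isolated n \<chi> = {v. v < n \<and> (\<forall>e\<in>dom \<chi>. v \<notin> e)}"

text \<open>\<open>W\<close> is a union of components, up to vertices without edges. Exhibiting such
  a set is how two vertices are shown to lie in different trees, without handling paths.\<close>

definition closed_in :: "edge set \<Rightarrow> nat set \<Rightarrow> bool" where
  "closed_in E W \<longleftrightarrow> (\<forall>e\<in>E. e \<subseteq> W \<or> e \<inter> W = {})"

text \<open>A relation instead of an indexed update sequence, so that finite runs compose by
  transitivity; \<open>moves_star_reachable\<close> translates back.\<close>

definition moves :: "nat \<Rightarrow> nat \<Rightarrow> (coloring \<Rightarrow> edge \<Rightarrow> coloring) \<Rightarrow> coloring \<Rightarrow> coloring \<Rightarrow> bool" where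
  "moves n \<Delta> A \<chi> \<chi>' \<longleftrightarrow> (\<exists>up. legal n \<Delta> (dom \<chi>) up \<and> \<chi>' = step A \<chi> up)"

section \<open>Components and acyclicity\<close>

lemma closed_in_same_tree:
  assumes "closed_in E W" "same_tree E x y"
  shows "x \<in> W \<longleftrightarrow> y \<in> W"
  using assms(2) unfolding same_tree_def
proof (induction rule: rtrancl_induct)
  case base
  then show ?case by simp
next
  case (step y z)
  then have "{y, z} \<in> E" by simp
  then have "{y, z} \<subseteq> W \<or> {y, z} \<inter> W = {}"
    using assms(1) unfolding closed_in_def by (rule bspec[rotated])
  then have "y \<in> W \<longleftrightarrow> z \<in> W"
    by fastforce
  with step.IH show ?case by simp
qed

lemma same_tree_sym: "same_tree E x y \<Longrightarrow> same_tree E y x"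
proof -
  have "sym {(x, y). {x, y} \<in> E}"
    by (auto simp: sym_def insert_commute)
  then show "same_tree E x y \<Longrightarrow> same_tree E y x"
    unfolding same_tree_def by (meson sym_rtrancl symD)
qed

text \<open>If two different indices gave the same edge, each would be the cyclic successor of the
  other, and the cycle would have length 2.\<close>

lemma cycle_edges_distinct:
  assumes d: "distinct vs" and L: "length vs \<ge> 3" and i: "i < length vs" and j: "j < length vs"
    and eq: "{vs ! i, vs ! (Suc i mod length vs)} = {vs ! j, vs ! (Suc j mod length vs)}"
  shows "i = j"
proof (rule ccontr)
  assume ne: "i \<noteq> j"
  let ?L = "length vs"
  have si: "Suc i mod ?L < ?L" and sj: "Suc j mod ?L < ?L"
    using L by (auto intro!: mod_less_divisor)
  have "vs ! i \<noteq> vs ! j"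
    using d i j ne nth_eq_iff_index_eq by blast
  with eq have "vs ! i = vs ! (Suc j mod ?L)" "vs ! j = vs ! (Suc i mod ?L)"
    by (auto simp: doubleton_eq_iff)
  then have 1: "i = Suc j mod ?L" and 2: "j = Suc i mod ?L"
    using d i j si sj nth_eq_iff_index_eq by blast+
  show False
  proof (cases "Suc j = ?L")
    case True
    then have "i = 0" using 1 by simp
    then show False using 2 True L by simp
  next
    case False
    then have "i = Suc j" using 1 j by simp
    then show False using 2 i L by (cases "Suc i = ?L") auto
  qed
qed

text \<open>A new cycle must use \<open>{u, v}\<close>, and by \<open>cycle_edges_distinct\<close>
  it does so only once. Its remaining edges form a walk in \<open>E\<close> between \<open>u\<close>
  and \<open>v\<close>.\<close>

lemma is_forest_insert:
  assumes F: "is_forest n E" and u: "u < n" and v: "v < n" and ns: "\<not> same_tree E u v"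
  shows "is_forest n (insert {u, v} E)"
proof -
  have uv: "u \<noteq> v"
    using ns unfolding same_tree_def by auto
  have sub: "insert {u, v} E \<subseteq> possible_edges n"
    using F u v uv unfolding is_forest_def possible_edges_def by (auto simp: card_insert_if)
  moreover have False if c: "is_cycle (insert {u, v} E) vs" for vs
  proof -
    let ?L = "length vs"
    have L: "?L \<ge> 3" and d: "distinct vs"
      and E: "\<And>i. i < ?L \<Longrightarrow> {vs ! i, vs ! (Suc i mod ?L)} \<in> insert {u, v} E"
      using c unfolding is_cycle_def by auto
    have "\<not> is_cycle E vs"
      using F unfolding is_forest_def by auto
    then obtain i where i: "i < ?L" "{vs ! i, vs ! (Suc i mod ?L)} \<notin> E"
      using L d unfolding is_cycle_def by auto
    with E have iuv: "{vs ! i, vs ! (Suc i mod ?L)} = {u, v}"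
      by blast
    have other: "{vs ! j, vs ! (Suc j mod ?L)} \<in> E" if "j < ?L" "j \<noteq> i" for j
      using E[OF that(1)] cycle_edges_distinct[OF d L that(1) i(1)] that(2) iuv by auto
    \<comment> \<open>The walk starts behind the new edge, which has index \<open>i\<close>; for
      \<open>k = length vs - 1\<close> the index \<open>i + Suc k\<close> has wrapped around to
      \<open>i\<close>.\<close>
    have walk: "same_tree E (vs ! (Suc i mod ?L)) (vs ! ((i + Suc k) mod ?L))" if "k < ?L" for k
      using that
    proof (induction k)
      case 0
      then show ?case unfolding same_tree_def by simp
    next
      case (Suc k)
      let ?j = "(i + Suc k) mod ?L"
      have j: "?j < ?L"
        using L by (auto intro!: mod_less_divisor)
      have "?j \<noteq> i"
      proof (cases "i + Suc k < ?L")
        case True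
        then show ?thesis by simp
      next
        case False
        then have "?j = i + Suc k - ?L"
          using i(1) Suc.prems by (simp add: le_mod_geq)
        then show ?thesis using Suc.prems False by linarith
      qed
      then have "{vs ! ?j, vs ! (Suc ?j mod ?L)} \<in> E"
        using other j by blast
      moreover have "Suc ?j mod ?L = (i + Suc (Suc k)) mod ?L"
        by (simp add: mod_Suc_eq)
      ultimately have "(vs ! ?j, vs ! ((i + Suc (Suc k)) mod ?L)) \<in> {(x, y). {x, y} \<in> E}"
        by simp
      with Suc show ?case
        unfolding same_tree_def by (meson Suc_lessD rtrancl.rtrancl_into_rtrancl)
    qed
    have "(i + Suc (?L - 1)) mod ?L = i"
      using i(1) L by (subst Suc_diff_1) auto
    then have "same_tree E (vs ! (Suc i mod ?L)) (vs ! i)"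
      using walk[of "?L - 1"] L by simp
    then have "same_tree E u v"
      using iuv same_tree_sym by (auto simp: doubleton_eq_iff)
    then show False using ns by simp
  qed
  ultimately show ?thesis
    unfolding is_forest_def by blast
qed

section \<open>Color sets, degrees and valid states\<close>

lemma finite_possible_edges: "finite (possible_edges n)"
  unfolding possible_edges_def by (rule finite_subset[of _ "Pow {..<n}"]) auto

lemma valid_edge:
  assumes "valid_state n \<Delta> \<kappa> \<chi>" "e \<in> dom \<chi>"
  shows "e \<subseteq> {..<n}" "card e = 2"
  using assms unfolding valid_state_def is_forest_def possible_edges_def by auto

lemma valid_finite: "valid_state n \<Delta> \<kappa> \<chi> \<Longrightarrow> finite (dom \<chi>)"
  unfolding valid_state_def is_forest_def
  using finite_possible_edges finite_subset by blast

lemma proper_same: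
  assumes "proper_coloring \<kappa> \<chi>" "\<chi> e = Some a" "\<chi> f = Some a" "v \<in> e" "v \<in> f"
  shows "e = f"
proof (rule ccontr)
  assume "e \<noteq> f"
  moreover have "e \<in> dom \<chi>" "f \<in> dom \<chi>" "e \<inter> f \<noteq> {}"
    using assms by auto
  ultimately have "\<chi> e \<noteq> \<chi> f"
    using assms(1) unfolding proper_coloring_def by blast
  with assms show False by simp
qed

lemma cols_subset: "proper_coloring \<kappa> \<chi> \<Longrightarrow> cols \<chi> v \<subseteq> {1..\<kappa>}"
  unfolding proper_coloring_def cols_def by (blast intro: ranI)

text \<open>Colors are injective on the edges at \<open>v\<close>. Degree conditions are therefore
  expressed through \<open>card (cols \<chi> v)\<close> from here on.\<close>

lemma degree_eq_card_cols:
  assumes "proper_coloring \<kappa> \<chi>"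
  shows "degree (dom \<chi>) v = card (cols \<chi> v)"
proof -
  let ?E = "{e \<in> dom \<chi>. v \<in> e}"
  have "cols \<chi> v = (\<lambda>e. the (\<chi> e)) ` ?E"
    unfolding cols_def by (force simp: image_iff)
  moreover have "inj_on (\<lambda>e. the (\<chi> e)) ?E"
    by (intro inj_onI) (metis (no_types, lifting) domD mem_Collect_eq option.sel proper_same[OF assms])
  ultimately show ?thesis
    unfolding degree_def by (simp add: card_image)
qed

lemma finite_cols: "valid_state n \<Delta> \<kappa> \<chi> \<Longrightarrow> finite (cols \<chi> v)"
  unfolding valid_state_def by (metis cols_subset finite_atLeastAtMost finite_subset)

lemma is_forest_mono: "is_forest n E \<Longrightarrow> E' \<subseteq> E \<Longrightarrow> is_forest n E'"
  unfolding is_forest_def is_cycle_def by (meson subset_eq subset_trans)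

lemma degree_mono: "finite E \<Longrightarrow> E' \<subseteq> E \<Longrightarrow> degree E' v \<le> degree E v"
  unfolding degree_def by (rule card_mono) auto

lemma proper_coloring_sub:
  assumes p: "proper_coloring \<kappa> \<chi>" and s: "\<chi>' \<subseteq>\<^sub>m \<chi>"
  shows "proper_coloring \<kappa> \<chi>'"
proof -
  have d: "dom \<chi>' \<subseteq> dom \<chi>"
    using s map_le_implies_dom_le by blast
  have eq: "\<chi>' e = \<chi> e" if "e \<in> dom \<chi>'" for e
    using s that unfolding map_le_def by blast
  have "ran \<chi>' \<subseteq> ran \<chi>"
    using eq unfolding ran_def by (force simp: domI)
  moreover have "\<forall>e\<in>dom \<chi>'. \<forall>f\<in>dom \<chi>'. e \<noteq> f \<and> e \<inter> f \<noteq> {} \<longrightarrow> \<chi>' e \<noteq> \<chi>' f"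
    using p d eq unfolding proper_coloring_def by (metis subsetD)
  ultimately show ?thesis
    using p unfolding proper_coloring_def by blast
qed

lemma valid_sub:
  assumes v: "valid_state n \<Delta> \<kappa> \<chi>" and s: "\<chi>' \<subseteq>\<^sub>m \<chi>"
  shows "valid_state n \<Delta> \<kappa> \<chi>'"
proof -
  have d: "dom \<chi>' \<subseteq> dom \<chi>"
    using s map_le_implies_dom_le by blast
  have "max_degree_le n \<Delta> (dom \<chi>')"
    using v d degree_mono[OF valid_finite[OF v] d] unfolding valid_state_def max_degree_le_def
    by (meson order_trans)
  then show ?thesis
    using v d is_forest_mono proper_coloring_sub[OF _ s] unfolding valid_state_def by blast
qed

text \<open>Deletions leave all other colors alone. Hence a construction only has to reach some
  extension of its target coloring, and temporary neighbors can be discarded afterwards.\<close>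

lemma moves_trim:
  assumes "valid_state n \<Delta> \<kappa> \<chi>" "\<chi>' \<subseteq>\<^sub>m \<chi>"
  shows "(moves n \<Delta> A)\<^sup>*\<^sup>* \<chi> \<chi>'"
  using assms
proof (induction "card (dom \<chi> - dom \<chi>')" arbitrary: \<chi>)
  case 0
  then have "dom \<chi> \<subseteq> dom \<chi>'"
    using valid_finite[OF "0.prems"(1)] by auto
  have "\<chi> x = \<chi>' x" for x
    using "0.prems"(2) \<open>dom \<chi> \<subseteq> dom \<chi>'\<close> unfolding map_le_def by (metis domIff subsetD)
  then have "\<chi> = \<chi>'" by blast
  then show ?case by simp
next
  case (Suc k)
  then obtain e where e: "e \<in> dom \<chi>" "e \<notin> dom \<chi>'"
    by (metis Diff_iff card.empty ex_in_conv nat.distinct(1))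
  let ?\<psi> = "\<chi>(e := None)"
  have le: "\<chi>' \<subseteq>\<^sub>m ?\<psi>"
    using Suc.prems(2) e(2) unfolding map_le_def by auto
  have "?\<psi> \<subseteq>\<^sub>m \<chi>"
    unfolding map_le_def by auto
  then have va: "valid_state n \<Delta> \<kappa> ?\<psi>"
    using Suc.prems(1) valid_sub by blast
  have "dom ?\<psi> - dom \<chi>' = (dom \<chi> - dom \<chi>') - {e}"
    by auto
  then have "k = card (dom ?\<psi> - dom \<chi>')"
    using Suc.hyps(2) e valid_finite[OF Suc.prems(1)] by (simp add: card_Diff_singleton)
  then have "(moves n \<Delta> A)\<^sup>*\<^sup>* ?\<psi> \<chi>'"
    using Suc.hyps(1) va le by blast
  moreover have "moves n \<Delta> A \<chi> ?\<psi>"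
    unfolding moves_def using e(1) by (intro exI[of _ "Del e"]) simp
  ultimately show ?case
    by (rule converse_rtranclp_into_rtranclp[of "moves n \<Delta> A", rotated])
qed

lemma valid_moves:
  assumes g: "greedy_rule n \<Delta> \<kappa> A" and v: "valid_state n \<Delta> \<kappa> \<chi>" and m: "moves n \<Delta> A \<chi> \<chi>'"
  shows "valid_state n \<Delta> \<kappa> \<chi>'"
proof -
  obtain up where up: "legal n \<Delta> (dom \<chi>) up" "\<chi>' = step A \<chi> up"
    using m unfolding moves_def by blast
  show ?thesis
  proof (cases up)
    case (Del e)
    then have "\<chi>' \<subseteq>\<^sub>m \<chi>"
      using up(2) unfolding map_le_def by auto
    then show ?thesis using v valid_sub by blast
  next
    case (Ins e)
    then have "greedy_outcome \<kappa> \<chi> e \<chi>'"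
      using g v up unfolding greedy_rule_def by auto
    then have d: "dom \<chi>' = insert e (dom \<chi>)" and p: "proper_coloring \<kappa> \<chi>'"
      unfolding greedy_outcome_def recolors_to_def by auto
    obtain x y where "x < n" "y < n" "e = {x, y}" "\<not> same_tree (dom \<chi>) x y"
      and "max_degree_le n \<Delta> (insert e (dom \<chi>))"
      using up(1) Ins by auto
    then show ?thesis
      using d p v is_forest_insert unfolding valid_state_def by simp
  qed
qed

lemma valid_moves_star:
  assumes "(moves n \<Delta> A)\<^sup>*\<^sup>* \<chi> \<chi>'" "greedy_rule n \<Delta> \<kappa> A" "valid_state n \<Delta> \<kappa> \<chi>"
  shows "valid_state n \<Delta> \<kappa> \<chi>'"
  using assms by (induction rule: rtranclp_induct) (auto intro: valid_moves)

lemma not_same_tree_edge: "\<not> same_tree (dom \<chi>) u v \<Longrightarrow> {u, v} \<notin> dom \<chi>"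
  unfolding same_tree_def by auto

lemma cols_upd:
  "{u, v} \<notin> dom \<chi> \<Longrightarrow>
    cols (\<chi>({u, v} \<mapsto> t)) x = (if x \<in> {u, v} then insert t (cols \<chi> x) else cols \<chi> x)"
  unfolding cols_def by (cases "x \<in> {u, v}") (auto simp: domIff, (metis option.distinct(1))+)

lemma map_le_upd_new: "e \<notin> dom \<chi> \<Longrightarrow> \<chi> \<subseteq>\<^sub>m \<chi>(e \<mapsto> t)"
  unfolding map_le_def by auto

lemma proper_coloring_insert:
  assumes p: "proper_coloring \<kappa> \<chi>" and t: "t \<in> {1..\<kappa>}" "t \<notin> cols \<chi> u" "t \<notin> cols \<chi> v"
    and new: "{u, v} \<notin> dom \<chi>"
  shows "proper_coloring \<kappa> (\<chi>({u, v} \<mapsto> t))"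
  unfolding proper_coloring_def
proof (intro conjI ballI impI)
  show "ran (\<chi>({u, v} \<mapsto> t)) \<subseteq> {1..\<kappa>}"
    using p t new unfolding proper_coloring_def by (auto simp: domIff)
next
  fix e f
  assume e: "e \<in> dom (\<chi>({u, v} \<mapsto> t))" and f: "f \<in> dom (\<chi>({u, v} \<mapsto> t))"
    and ef: "e \<noteq> f \<and> e \<inter> f \<noteq> {}"
  have avoid: "\<chi> g \<noteq> Some t" if "g \<inter> {u, v} \<noteq> {}" for g
    using t that unfolding cols_def by blast
  show "(\<chi>({u, v} \<mapsto> t)) e \<noteq> (\<chi>({u, v} \<mapsto> t)) f"
  proof (cases "e = {u, v} \<or> f = {u, v}")
    case True
    then show ?thesis
      using ef avoid[of e] avoid[of f] by (auto split: if_splits)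
  next
    case False
    then show ?thesis
      using e f ef p unfolding proper_coloring_def by auto
  qed
qed

section \<open>Insertions with a free color\<close>

lemma legal_insert:
  assumes v: "valid_state n \<Delta> \<kappa> \<chi>" and xy: "x < n" "y < n" and ns: "\<not> same_tree (dom \<chi>) x y"
    and dx: "card (cols \<chi> x) < \<Delta>" and dy: "card (cols \<chi> y) < \<Delta>"
  shows "legal n \<Delta> (dom \<chi>) (Ins {x, y})"
proof -
  have p: "proper_coloring \<kappa> \<chi>" using v unfolding valid_state_def by simp
  have "degree (insert {x, y} (dom \<chi>)) z \<le> \<Delta>" if z: "z < n" for z
  proof (cases "z \<in> {x, y}")
    case True
    then have "{e \<in> insert {x, y} (dom \<chi>). z \<in> e} = insert {x, y} {e \<in> dom \<chi>. z \<in> e}"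
      by auto
    then have "degree (insert {x, y} (dom \<chi>)) z \<le> Suc (degree (dom \<chi>) z)"
      unfolding degree_def using valid_finite[OF v] by (simp add: card_insert_if)
    then show ?thesis
      using True dx dy degree_eq_card_cols[OF p, of z] by auto
  next
    case False
    then have "{e \<in> insert {x, y} (dom \<chi>). z \<in> e} = {e \<in> dom \<chi>. z \<in> e}"
      by auto
    then show ?thesis
      using v z unfolding degree_def valid_state_def max_degree_le_def by simp
  qed
  then show ?thesis
    using xy ns by (auto simp: max_degree_le_def)
qed

lemma valid_insert:
  assumes "valid_state n \<Delta> \<kappa> \<chi>" "x < n" "y < n" "\<not> same_tree (dom \<chi>) x y"
    and "card (cols \<chi> x) < \<Delta>" "card (cols \<chi> y) < \<Delta>"
    and "t \<in> {1..\<kappa>}" "t \<notin> cols \<chi> x" "t \<notin> cols \<chi> y"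
  shows "valid_state n \<Delta> \<kappa> (\<chi>({x, y} \<mapsto> t))"
  using legal_insert[OF assms(1-6)] is_forest_insert[OF _ assms(2-4)] assms(1)
    proper_coloring_insert[OF _ assms(7-9) not_same_tree_edge[OF assms(4)]]
  unfolding valid_state_def by simp

text \<open>A color free at both ends makes the empty set admissible, so every minimum
  \<open>H\<close> is empty and the old colors stay. Only the choice of \<open>t\<close> among the
  free colors is up to the rule; it is determined when a single color is free.\<close>

lemma moves_insert:
  assumes g: "greedy_rule n \<Delta> \<kappa> A" and v: "valid_state n \<Delta> \<kappa> \<chi>"
    and xy: "x < n" "y < n" and ns: "\<not> same_tree (dom \<chi>) x y"
    and dx: "card (cols \<chi> x) < \<Delta>" and dy: "card (cols \<chi> y) < \<Delta>"
    and cc: "card (cols \<chi> x \<union> cols \<chi> y) < \<kappa>"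
  obtains t where "moves n \<Delta> A \<chi> (\<chi>({x, y} \<mapsto> t))" "t \<in> {1..\<kappa>}" "t \<notin> cols \<chi> x" "t \<notin> cols \<chi> y"
proof -
  let ?e = "{x, y}"
  have p: "proper_coloring \<kappa> \<chi>" using v unfolding valid_state_def by simp
  have new: "?e \<notin> dom \<chi>" using ns by (rule not_same_tree_edge)
  have leg: "legal n \<Delta> (dom \<chi>) (Ins ?e)"
    using legal_insert[OF v xy ns dx dy] .
  have "\<not> {1..\<kappa>} \<subseteq> cols \<chi> x \<union> cols \<chi> y"
    using cc card_mono[of "cols \<chi> x \<union> cols \<chi> y" "{1..\<kappa>}"] finite_cols[OF v] by auto
  then obtain s where s: "s \<in> {1..\<kappa>}" "s \<notin> cols \<chi> x" "s \<notin> cols \<chi> y" by blast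
  have "can_recolor \<kappa> \<chi> ?e {}"
    unfolding can_recolor_def recolors_to_def
    using proper_coloring_insert[OF p s new] new
    by (intro conjI exI[of _ "\<chi>(?e \<mapsto> s)"]) auto
  moreover have "greedy_outcome \<kappa> \<chi> ?e (A \<chi> ?e)"
    using g v leg unfolding greedy_rule_def by blast
  then obtain H where H: "is_arg_min card (can_recolor \<kappa> \<chi> ?e) H" "recolors_to \<kappa> \<chi> ?e H (A \<chi> ?e)"
    unfolding greedy_outcome_def by blast
  ultimately have "card H = 0" "H \<subseteq> dom \<chi>"
    unfolding is_arg_min_def can_recolor_def by auto
  then have "H = {}"
    using finite_subset[OF _ valid_finite[OF v]] by simp
  then have R: "dom (A \<chi> ?e) = insert ?e (dom \<chi>)" "proper_coloring \<kappa> (A \<chi> ?e)"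
    "\<forall>f\<in>dom \<chi>. A \<chi> ?e f = \<chi> f"
    using H(2) unfolding recolors_to_def by auto
  have "?e \<in> dom (A \<chi> ?e)" unfolding R(1) by simp
  then obtain t where t: "A \<chi> ?e ?e = Some t" by (rule domD[THEN exE])
  have Aeq: "A \<chi> ?e = \<chi>(?e \<mapsto> t)"
  proof
    fix f show "A \<chi> ?e f = (\<chi>(?e \<mapsto> t)) f"
      using R(1,3) t by (cases "f \<in> dom \<chi>"; cases "f = ?e") (auto simp: domIff)
  qed
  have "t \<in> {1..\<kappa>}"
    using R(2) t unfolding proper_coloring_def by (blast intro: ranI)
  moreover have "t \<notin> cols \<chi> z" if "z \<in> ?e" for z
  proof
    assume "t \<in> cols \<chi> z"
    then obtain f where f: "\<chi> f = Some t" "z \<in> f" unfolding cols_def by blast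
    then have "A \<chi> ?e f = Some t" using R(3) by (metis domI)
    then have "f = ?e" using proper_same[OF R(2) _ t f(2) that] by blast
    then show False using f(1) new by auto
  qed
  moreover have "moves n \<Delta> A \<chi> (\<chi>(?e \<mapsto> t))"
    unfolding moves_def using leg Aeq step.simps(1)[of A \<chi> ?e] by metis
  ultimately show ?thesis using that by blast
qed

lemma moves_star_reachable:
  assumes "(moves n \<Delta> A)\<^sup>*\<^sup>* Map.empty \<chi>"
  shows "reachable n \<Delta> A \<chi>"
  using assms
proof (induction rule: rtranclp_induct)
  case base
  show ?case
    unfolding reachable_def by (rule exI[of _ undefined], rule exI[of _ 0]) simp
next
  case (step \<chi> \<chi>')
  then obtain \<sigma> T up where s: "\<forall>t<T. legal n \<Delta> (dom (run A Map.empty \<sigma> t)) (\<sigma> t)"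
    "run A Map.empty \<sigma> T = \<chi>" and up: "legal n \<Delta> (dom \<chi>) up" "\<chi>' = Defs.step A \<chi> up"
    unfolding reachable_def moves_def by blast
  let ?\<tau> = "\<sigma>(T := up)"
  have run: "run A Map.empty ?\<tau> t = run A Map.empty \<sigma> t" if "t \<le> T" for t
    using that by (induction t) auto
  have "\<forall>t<Suc T. legal n \<Delta> (dom (run A Map.empty ?\<tau> t)) (?\<tau> t)"
    using s up run by (auto simp: less_Suc_eq)
  moreover have "run A Map.empty ?\<tau> (Suc T) = \<chi>'"
    using s up run[of T] by simp
  ultimately show ?case
    unfolding reachable_def by blast
qed

section \<open>Building prescribed colorings\<close>

text \<open>\<open>W\<close> is the footprint of a construction: color sets and isolated vertices
  outside \<open>W\<close> survive, so constructions in disjoint vertex sets do not disturb each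
  other.\<close>

definition grows ::
  "nat \<Rightarrow> nat \<Rightarrow> (coloring \<Rightarrow> edge \<Rightarrow> coloring) \<Rightarrow> coloring \<Rightarrow> coloring \<Rightarrow> nat set \<Rightarrow> bool" where
  "grows n \<Delta> A \<chi> \<chi>' W \<longleftrightarrow>
     (moves n \<Delta> A)\<^sup>*\<^sup>* \<chi> \<chi>' \<and> \<chi> \<subseteq>\<^sub>m \<chi>' \<and> (\<forall>e\<in>dom \<chi>' - dom \<chi>. e \<subseteq> W)"

text \<open>Because \<open>n\<close>, the rule, the state and \<open>S\<close> are quantified
  inside, the number \<open>M\<close> of scratch vertices depends on none of them; this is what
  later gives a threshold independent of the rule. The vertex \<open>z\<close> is not prescribed,
  since the rule influences which vertex succeeds.\<close>

definition makes :: "nat \<Rightarrow> nat \<Rightarrow> (nat set \<Rightarrow> bool) \<Rightarrow> nat \<Rightarrow> bool" where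
  "makes \<Delta> \<kappa> Q M \<longleftrightarrow> (\<forall>n A \<chi> S. greedy_rule n \<Delta> \<kappa> A \<longrightarrow> valid_state n \<Delta> \<kappa> \<chi> \<longrightarrow>
     S \<subseteq> isolated n \<chi> \<longrightarrow> M \<le> card S \<longrightarrow> (\<exists>\<chi>' z. z \<in> S \<and> grows n \<Delta> A \<chi> \<chi>' S \<and> Q (cols \<chi>' z)))"

lemma grows_refl: "grows n \<Delta> A \<chi> \<chi> W"
  unfolding grows_def by simp

lemma grows_mono: "grows n \<Delta> A \<chi> \<chi>' W \<Longrightarrow> W \<subseteq> W' \<Longrightarrow> grows n \<Delta> A \<chi> \<chi>' W'"
  unfolding grows_def by blast

lemma grows_trans:
  assumes "grows n \<Delta> A \<chi> \<chi>' W" "grows n \<Delta> A \<chi>' \<chi>'' W"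
  shows "grows n \<Delta> A \<chi> \<chi>'' W"
  using assms unfolding grows_def
  by (metis (no_types, lifting) Diff_iff map_le_trans rtranclp_trans)

lemma grows_valid:
  "grows n \<Delta> A \<chi> \<chi>' W \<Longrightarrow> greedy_rule n \<Delta> \<kappa> A \<Longrightarrow> valid_state n \<Delta> \<kappa> \<chi> \<Longrightarrow> valid_state n \<Delta> \<kappa> \<chi>'"
  unfolding grows_def using valid_moves_star by blast

lemma cols_mono: "\<chi> \<subseteq>\<^sub>m \<chi>' \<Longrightarrow> cols \<chi> v \<subseteq> cols \<chi>' v"
  unfolding cols_def map_le_def by (smt (verit, best) Collect_mono domI)

lemma cols_extend:
  assumes "\<chi> \<subseteq>\<^sub>m \<chi>'" "\<And>e. e \<in> dom \<chi>' - dom \<chi> \<Longrightarrow> v \<notin> e"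
  shows "cols \<chi>' v = cols \<chi> v"
proof
  show "cols \<chi> v \<subseteq> cols \<chi>' v" using cols_mono[OF assms(1)] .
  show "cols \<chi>' v \<subseteq> cols \<chi> v"
  proof
    fix a assume "a \<in> cols \<chi>' v"
    then obtain e where e: "\<chi>' e = Some a" "v \<in> e" unfolding cols_def by blast
    then have "e \<in> dom \<chi>" using assms(2)[of e] by (auto simp: dom_def)
    then have "\<chi> e = Some a" using e(1) assms(1) unfolding map_le_def by metis
    then show "a \<in> cols \<chi> v" unfolding cols_def using e(2) by blast
  qed
qed

lemma grows_cols:
  assumes "grows n \<Delta> A \<chi> \<chi>' W" "v \<notin> W"
  shows "cols \<chi>' v = cols \<chi> v"
  using assms unfolding grows_def by (intro cols_extend) blast+

lemma grows_isolated:
  assumes "grows n \<Delta> A \<chi> \<chi>' W"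
  shows "isolated n \<chi> - W \<subseteq> isolated n \<chi>'"
  using assms unfolding grows_def isolated_def by blast

lemma isolated_cols: "v \<in> isolated n \<chi> \<Longrightarrow> cols \<chi> v = {}"
  unfolding isolated_def cols_def by blast

lemma finite_isolated: "finite (isolated n \<chi>)"
  unfolding isolated_def by simp

lemma isolated_sub: "\<chi> \<subseteq>\<^sub>m \<chi>' \<Longrightarrow> isolated n \<chi>' \<subseteq> isolated n \<chi>"
  unfolding isolated_def by (auto dest!: map_le_implies_dom_le)

lemma isolated_closed: "S \<subseteq> isolated n \<chi> \<Longrightarrow> closed_in (dom \<chi>) S"
  unfolding closed_in_def isolated_def by blast

lemma grows_closed:
  assumes "grows n \<Delta> A \<chi> \<chi>' W" "closed_in (dom \<chi>) V" "W \<subseteq> V \<or> W \<inter> V = {}"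
  shows "closed_in (dom \<chi>') V"
  unfolding closed_in_def
proof
  fix e assume "e \<in> dom \<chi>'"
  then consider "e \<in> dom \<chi>" | "e \<subseteq> W"
    using assms(1) unfolding grows_def by blast
  then show "e \<subseteq> V \<or> e \<inter> V = {}"
    using assms(2,3) unfolding closed_in_def by cases blast+
qed

lemma closed_not_same_tree:
  "closed_in E W \<Longrightarrow> x \<notin> W \<Longrightarrow> y \<in> W \<Longrightarrow> \<not> same_tree E x y"
  using closed_in_same_tree by blast

lemma grows_insert:
  assumes g: "greedy_rule n \<Delta> \<kappa> A" and v: "valid_state n \<Delta> \<kappa> \<chi>"
    and "x < n" "y < n" and ns: "\<not> same_tree (dom \<chi>) x y"
    and "card (cols \<chi> x) < \<Delta>" "card (cols \<chi> y) < \<Delta>" "card (cols \<chi> x \<union> cols \<chi> y) < \<kappa>"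
  obtains t where "grows n \<Delta> A \<chi> (\<chi>({x, y} \<mapsto> t)) {x, y}" "t \<in> {1..\<kappa>}" "t \<notin> cols \<chi> x" "t \<notin> cols \<chi> y"
    "cols (\<chi>({x, y} \<mapsto> t)) x = insert t (cols \<chi> x)" "cols (\<chi>({x, y} \<mapsto> t)) y = insert t (cols \<chi> y)"
proof -
  obtain t where "moves n \<Delta> A \<chi> (\<chi>({x, y} \<mapsto> t))" "t \<in> {1..\<kappa>}" "t \<notin> cols \<chi> x" "t \<notin> cols \<chi> y"
    using moves_insert[OF assms] .
  moreover have new: "{x, y} \<notin> dom \<chi>" using not_same_tree_edge[OF ns] .
  ultimately show ?thesis
    using map_le_upd_new[OF new] cols_upd[OF new]
    by (intro that[of t]) (auto simp: grows_def)
qed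

lemma grows_pad:
  assumes g: "greedy_rule n \<Delta> \<kappa> A" and v: "valid_state n \<Delta> \<kappa> \<chi>" and k\<Delta>: "\<Delta> \<le> \<kappa>"
    and u: "u < n" "u \<notin> S" and S: "S \<subseteq> isolated n \<chi>" "k \<le> card S" and ck: "card (cols \<chi> u) + k \<le> \<Delta>"
  shows "\<exists>\<chi>'. grows n \<Delta> A \<chi> \<chi>' (insert u S) \<and> card (cols \<chi>' u) = card (cols \<chi> u) + k"
  using v S ck u(2)
proof (induction k arbitrary: \<chi> S)
  case 0
  then show ?case using grows_refl by (intro exI[of _ \<chi>]) simp
next
  case (Suc k)
  then obtain y where y: "y \<in> S" by fastforce
  then have "y \<in> isolated n \<chi>" using Suc.prems(2) by blast
  then have yf: "y \<in> isolated n \<chi>" "y < n" "cols \<chi> y = {}"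
    using isolated_cols unfolding isolated_def by auto
  have ns: "\<not> same_tree (dom \<chi>) u y"
    using closed_not_same_tree[OF isolated_closed[OF Suc.prems(2)] Suc.prems(5) y] .
  have lt: "card (cols \<chi> u) < \<Delta>" using Suc.prems(4) by simp
  then have "card (cols \<chi> y) < \<Delta>" "card (cols \<chi> u \<union> cols \<chi> y) < \<kappa>"
    using yf(3) k\<Delta> by auto
  from grows_insert[OF g Suc.prems(1) u(1) yf(2) ns lt this]
  obtain t where t: "grows n \<Delta> A \<chi> (\<chi>({u, y} \<mapsto> t)) {u, y}" "t \<notin> cols \<chi> u"
    "cols (\<chi>({u, y} \<mapsto> t)) u = insert t (cols \<chi> u)" by metis
  let ?\<chi> = "\<chi>({u, y} \<mapsto> t)"
  have fin: "finite S" using Suc.prems(2) finite_isolated finite_subset by blast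
  have c: "card (cols ?\<chi> u) = Suc (card (cols \<chi> u))"
    using t finite_cols[OF Suc.prems(1)] by simp
  have "S - {y} \<subseteq> isolated n ?\<chi>"
    using grows_isolated[OF t(1)] Suc.prems(2,5) by blast
  moreover have "valid_state n \<Delta> \<kappa> ?\<chi>"
    using grows_valid[OF t(1) g Suc.prems(1)] .
  moreover have "k \<le> card (S - {y})" using Suc.prems(3) y fin by simp
  moreover have "card (cols ?\<chi> u) + k \<le> \<Delta>" using c Suc.prems(4) by simp
  moreover have "u \<notin> S - {y}" using Suc.prems(5) by simp
  ultimately obtain \<chi>' where x: "grows n \<Delta> A ?\<chi> \<chi>' (insert u (S - {y}))"
    "card (cols \<chi>' u) = card (cols ?\<chi> u) + k"
    using Suc.IH by blast
  have "grows n \<Delta> A \<chi> \<chi>' (insert u S)"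
    by (rule grows_trans[OF grows_mono[OF t(1)] grows_mono[OF x(1)]]) (use y in auto)
  then show ?case using x(2) c by auto
qed

section \<open>Realizing a color set at an unspecified vertex\<close>

lemma makes_mono: "makes \<Delta> \<kappa> Q M \<Longrightarrow> M \<le> M' \<Longrightarrow> makes \<Delta> \<kappa> Q M'"
  unfolding makes_def by (meson order_trans)

text \<open>Unwanted colors at \<open>z\<close> disappear by deleting their edges, so an exact color
  set is no harder to obtain than a superset.\<close>

lemma makes_trim:
  assumes m: "makes \<Delta> \<kappa> (\<lambda>C. Y \<subseteq> C) M"
  shows "makes \<Delta> \<kappa> (\<lambda>C. C = Y) M"
  unfolding makes_def
proof (intro allI impI)
  fix n A \<chi> S
  assume g: "greedy_rule n \<Delta> \<kappa> A" and v: "valid_state n \<Delta> \<kappa> \<chi>"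
    and S: "S \<subseteq> isolated n \<chi>" "M \<le> card S"
  then obtain \<chi>' z where z: "z \<in> S" and gr: "grows n \<Delta> A \<chi> \<chi>' S" and Y: "Y \<subseteq> cols \<chi>' z"
    using m unfolding makes_def by blast
  \<comment> \<open>The old edges stay so that the result still extends \<open>\<chi>\<close>. Of
    the new edges only those at \<open>z\<close> with a color of \<open>Y\<close> are kept.\<close>
  define D where "D = dom \<chi> \<union> {e \<in> dom \<chi>'. z \<in> e \<and> the (\<chi>' e) \<in> Y}"
  let ?\<psi> = "\<chi>' |` D"
  have le: "\<chi> \<subseteq>\<^sub>m ?\<psi>"
    using gr unfolding grows_def map_le_def D_def by simp
  have le': "?\<psi> \<subseteq>\<^sub>m \<chi>'"
    unfolding map_le_def by (auto simp: restrict_map_def split: if_splits)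
  have "(moves n \<Delta> A)\<^sup>*\<^sup>* \<chi> ?\<psi>"
    using gr moves_trim[OF grows_valid[OF gr g v] le'] unfolding grows_def by (meson rtranclp_trans)
  moreover have "dom ?\<psi> \<subseteq> dom \<chi>'"
    using le' map_le_implies_dom_le by blast
  ultimately have "grows n \<Delta> A \<chi> ?\<psi> S"
    using gr le unfolding grows_def by blast
  moreover have "cols ?\<psi> z = Y"
  proof
    have "e \<notin> dom \<chi>" if "z \<in> e" for e
      using that z S unfolding isolated_def by blast
    then show "cols ?\<psi> z \<subseteq> Y"
      unfolding cols_def D_def restrict_map_def by (auto split: if_splits)
    show "Y \<subseteq> cols ?\<psi> z"
    proof
      fix a assume a: "a \<in> Y"
      then obtain e where "\<chi>' e = Some a" "z \<in> e" using Y unfolding cols_def by blast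
      then have "?\<psi> e = Some a" using a unfolding D_def by (auto simp: restrict_map_def)
      then show "a \<in> cols ?\<psi> z" unfolding cols_def using \<open>z \<in> e\<close> by blast
    qed
  qed
  ultimately show "\<exists>\<chi>' z. z \<in> S \<and> grows n \<Delta> A \<chi> \<chi>' S \<and> cols \<chi>' z = Y"
    using z by blast
qed

text \<open>The rule picks the additional colors; only their number is under control. This is why a
  pigeonhole argument is needed afterwards.\<close>

lemma makes_pad:
  assumes m: "makes \<Delta> \<kappa> (\<lambda>C. C = X) M" and X: "card X + k \<le> \<Delta>" and k\<Delta>: "\<Delta> \<le> \<kappa>"
  shows "makes \<Delta> \<kappa> (\<lambda>C. X \<subseteq> C \<and> card C = card X + k) (M + k)"
  unfolding makes_def
proof (intro allI impI)
  fix n A \<chi> S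
  assume g: "greedy_rule n \<Delta> \<kappa> A" and v: "valid_state n \<Delta> \<kappa> \<chi>"
    and S: "S \<subseteq> isolated n \<chi>" "M + k \<le> card S"
  obtain S1 where S1: "S1 \<subseteq> S" "card S1 = M" "finite S1"
    using S(2) by (meson add_leE obtain_subset_with_card_n)
  then have c2: "k \<le> card (S - S1)"
    using S(2) by (simp add: card_Diff_subset)
  obtain \<chi>1 z where z: "z \<in> S1" and gr: "grows n \<Delta> A \<chi> \<chi>1 S1" and Y: "cols \<chi>1 z = X"
    using m g v S1 S unfolding makes_def by (metis order_refl subset_trans)
  have "S - S1 \<subseteq> isolated n \<chi>1"
    using grows_isolated[OF gr] S by blast
  moreover have "z < n" using z S1 S unfolding isolated_def by blast
  ultimately obtain \<chi>' where x: "grows n \<Delta> A \<chi>1 \<chi>' (insert z (S - S1))"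
    "card (cols \<chi>' z) = card X + k"
    using grows_pad[OF g grows_valid[OF gr g v] k\<Delta>, of z "S - S1" k] z X Y c2 by auto
  moreover have "X \<subseteq> cols \<chi>' z"
    using x(1) Y cols_mono unfolding grows_def by blast
  moreover have "grows n \<Delta> A \<chi> \<chi>' S"
    by (rule grows_trans[OF grows_mono[OF gr] grows_mono[OF x(1)]]) (use z S1 in auto)
  ultimately show "\<exists>\<chi>' z. z \<in> S \<and> grows n \<Delta> A \<chi> \<chi>' S \<and> X \<subseteq> cols \<chi>' z \<and> card (cols \<chi>' z) = card X + k"
    using z S1 by blast
qed

text \<open>Running the construction in disjoint parts of \<open>S\<close> puts the vertices
  \<open>f i\<close> into different closed sets. They can therefore all be joined to a common vertex
  later without closing a cycle.\<close>

lemma makes_many: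
  assumes m: "makes \<Delta> \<kappa> Q M"
  shows "greedy_rule n \<Delta> \<kappa> A \<Longrightarrow> valid_state n \<Delta> \<kappa> \<chi> \<Longrightarrow> S \<subseteq> isolated n \<chi> \<Longrightarrow> N * M \<le> card S \<Longrightarrow>
    \<exists>\<chi>' f W. grows n \<Delta> A \<chi> \<chi>' S \<and> (\<forall>i<N. Q (cols \<chi>' (f i)) \<and> f i \<in> W i \<and> W i \<subseteq> S \<and>
      closed_in (dom \<chi>') (W i)) \<and> (\<forall>i<N. \<forall>j<N. i \<noteq> j \<longrightarrow> W i \<inter> W j = {})"
proof (induction N arbitrary: S)
  case 0
  then show ?case using grows_refl by (intro exI[of _ \<chi>]) simp
next
  case (Suc N)
  have "M \<le> card S" using Suc.prems(4) by simp
  then obtain S1 where S1: "S1 \<subseteq> S" "card S1 = M" "finite S1"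
    by (meson obtain_subset_with_card_n)
  have "N * M \<le> card (S - S1)"
    using Suc.prems(4) S1 by (simp add: card_Diff_subset)
  then obtain \<chi>1 f W where gr: "grows n \<Delta> A \<chi> \<chi>1 (S - S1)"
    and P: "\<And>i. i < N \<Longrightarrow> Q (cols \<chi>1 (f i)) \<and> f i \<in> W i \<and> W i \<subseteq> S - S1 \<and> closed_in (dom \<chi>1) (W i)"
    and dj: "\<forall>i<N. \<forall>j<N. i \<noteq> j \<longrightarrow> W i \<inter> W j = {}"
    using Suc.IH[OF Suc.prems(1,2), of "S - S1"] Suc.prems(3) by blast
  have S1f: "S1 \<subseteq> isolated n \<chi>1"
    using grows_isolated[OF gr] Suc.prems(3) S1 by blast
  then obtain \<chi>' z where z: "z \<in> S1" and gr': "grows n \<Delta> A \<chi>1 \<chi>' S1" and Q: "Q (cols \<chi>' z)"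
    using m Suc.prems(1) grows_valid[OF gr Suc.prems(1,2)] S1(2) unfolding makes_def
    by (metis order_refl)
  have "grows n \<Delta> A \<chi> \<chi>' S"
    by (rule grows_trans[OF grows_mono[OF gr] grows_mono[OF gr']]) (use S1 in auto)
  moreover have "Q (cols \<chi>' ((f(N := z)) i)) \<and> (f(N := z)) i \<in> (W(N := S1)) i \<and>
      (W(N := S1)) i \<subseteq> S \<and> closed_in (dom \<chi>') ((W(N := S1)) i)" if i: "i < Suc N" for i
  proof (cases "i = N")
    case True
    then show ?thesis
      using Q z S1(1) grows_closed[OF gr' isolated_closed[OF S1f]] by simp
  next
    case False
    then have iN: "i < N" using i by simp
    then have "cols \<chi>' (f i) = cols \<chi>1 (f i)"
      using P[OF iN] by (intro grows_cols[OF gr']) blast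
    moreover have "closed_in (dom \<chi>') (W i)"
      using P[OF iN] by (intro grows_closed[OF gr']) blast+
    ultimately show ?thesis
      using P[OF iN] False by auto
  qed
  moreover have "\<forall>i<Suc N. \<forall>j<Suc N. i \<noteq> j \<longrightarrow> (W(N := S1)) i \<inter> (W(N := S1)) j = {}"
    using P dj by (auto simp: less_Suc_eq)
  ultimately show ?case
    by (intro exI[of _ \<chi>'] exI[of _ "f(N := z)"] exI[of _ "W(N := S1)"]) blast
qed

lemma pigeonhole_fibre:
  fixes f :: "'a \<Rightarrow> 'b"
  assumes "finite B" "f ` I \<subseteq> B" "card B * k < card I" "finite I"
  obtains b where "b \<in> B" "k < card {i \<in> I. f i = b}"
proof -
  have "\<exists>b\<in>B. k < card {i \<in> I. f i = b}"
  proof (rule ccontr)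
    assume "\<not> ?thesis"
    then have le: "\<And>b. b \<in> B \<Longrightarrow> card {i \<in> I. f i = b} \<le> k" by force
    have "I = (\<Union>b\<in>B. {i \<in> I. f i = b})" using assms(2) by auto
    then have "card I \<le> (\<Sum>b\<in>B. card {i \<in> I. f i = b})"
      using card_UN_le[OF assms(1)] by metis
    also have "\<dots> \<le> card B * k"
      using sum_bounded_above[of B "\<lambda>b. card {i \<in> I. f i = b}" k] le by simp
    finally show False using assms(3) by simp
  qed
  then show ?thesis using that by blast
qed

text \<open>All these vertices see the same \<open>\<Delta> - 1\<close> colors, so joining \<open>c + 1\<close> of them to one fresh vertex
  uses up all the remaining colors.\<close>

lemma grows_join:
  assumes g: "greedy_rule n \<Delta> \<kappa> A" and v: "valid_state n \<Delta> \<kappa> \<chi>"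
    and \<kappa>: "\<kappa> = \<Delta> + c" "c < \<Delta>"
    and w: "w \<in> isolated n \<chi>"
    and W: "\<And>j. j \<in> J \<Longrightarrow> closed_in (dom \<chi>) (W j) \<and> f j \<in> W j \<and> W j \<subseteq> {..<n} \<and> cols \<chi> (f j) = X \<and> w \<notin> W j"
    and dj: "\<And>i j. i \<in> J \<Longrightarrow> j \<in> J \<Longrightarrow> i \<noteq> j \<Longrightarrow> W i \<inter> W j = {}"
    and X: "card X = \<Delta> - 1" "finite X" and J: "finite J" "card J \<le> Suc c"
  shows "\<exists>\<chi>'. grows n \<Delta> A \<chi> \<chi>' (insert w (f ` J)) \<and> card (cols \<chi>' w) = card J \<and>
    cols \<chi>' w \<subseteq> {1..\<kappa>} - X \<and> (\<forall>a\<in>cols \<chi>' w. \<exists>j\<in>J. insert a X \<subseteq> cols \<chi>' (f j))"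
  using J W dj
proof (induction J rule: finite_induct)
  case empty
  then show ?case using grows_refl isolated_cols[OF w] by (intro exI[of _ \<chi>]) simp
next
  case (insert j J)
  then obtain \<chi>1 where gr: "grows n \<Delta> A \<chi> \<chi>1 (insert w (f ` J))" and c1: "card (cols \<chi>1 w) = card J"
    and s1: "cols \<chi>1 w \<subseteq> {1..\<kappa>} - X"
    and a1: "\<And>a. a \<in> cols \<chi>1 w \<Longrightarrow> \<exists>j\<in>J. insert a X \<subseteq> cols \<chi>1 (f j)"
    by auto
  have Wj: "closed_in (dom \<chi>) (W j)" "f j \<in> W j" "f j < n" "cols \<chi> (f j) = X" "w \<notin> W j"
    using insert.prems(2)[of j] by auto
  have out: "insert w (f ` J) \<inter> W j = {}"
    using Wj(5) insert.prems(2,3) insert.hyps(2) by (auto; metis disjoint_iff)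
  have ns: "\<not> same_tree (dom \<chi>1) w (f j)"
    using closed_not_same_tree[OF grows_closed[OF gr Wj(1)] Wj(5,2)] out by blast
  have cj: "cols \<chi>1 (f j) = X"
    using grows_cols[OF gr] out Wj(2,4) by blast
  have v1: "valid_state n \<Delta> \<kappa> \<chi>1" using grows_valid[OF gr g v] .
  have cJ: "card J \<le> c" using insert.prems(1) insert.hyps by simp
  have d1: "card (cols \<chi>1 w) < \<Delta>" "card (cols \<chi>1 (f j)) < \<Delta>"
    using c1 cJ cj X \<kappa> by auto
  have "card (cols \<chi>1 w \<union> cols \<chi>1 (f j)) \<le> card J + (\<Delta> - 1)"
    using card_Un_le[of "cols \<chi>1 w" X] c1 cj X by simp
  \<comment> \<open>Before each join \<open>w\<close> has at most \<open>c\<close> colors and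
    \<open>f j\<close> has \<open>\<Delta> - 1\<close>, one less than \<open>\<Delta> + c\<close> in
    total, so a color is free even for the last of the \<open>c + 1\<close> joins.\<close>
  then have d2: "card (cols \<chi>1 w \<union> cols \<chi>1 (f j)) < \<kappa>"
    using cJ \<kappa> by simp
  have wn: "w < n" using w unfolding isolated_def by simp
  obtain t where t: "grows n \<Delta> A \<chi>1 (\<chi>1({w, f j} \<mapsto> t)) {w, f j}" "t \<in> {1..\<kappa>}"
    "t \<notin> cols \<chi>1 w" "t \<notin> cols \<chi>1 (f j)" "cols (\<chi>1({w, f j} \<mapsto> t)) w = insert t (cols \<chi>1 w)"
    "cols (\<chi>1({w, f j} \<mapsto> t)) (f j) = insert t (cols \<chi>1 (f j))"
    using grows_insert[OF g v1 wn Wj(3) ns d1 d2] .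
  let ?\<chi> = "\<chi>1({w, f j} \<mapsto> t)"
  have "grows n \<Delta> A \<chi> ?\<chi> (insert w (f ` insert j J))"
    by (rule grows_trans[OF grows_mono[OF gr] grows_mono[OF t(1)]]) auto
  moreover have "card (cols ?\<chi> w) = card (insert j J)"
    using t(3,5) c1 finite_cols[OF v1] insert.hyps by simp
  moreover have "cols ?\<chi> w \<subseteq> {1..\<kappa>} - X"
    using t(2,4,5) s1 cj by auto
  moreover have "\<exists>i\<in>insert j J. insert a X \<subseteq> cols ?\<chi> (f i)" if a: "a \<in> cols ?\<chi> w" for a
  proof (cases "a = t")
    case True
    then show ?thesis using t(6) cj by blast
  next
    case False
    then obtain i where "i \<in> J" "insert a X \<subseteq> cols \<chi>1 (f i)"
      using a t(5) a1 by blast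
    moreover have "cols \<chi>1 (f i) \<subseteq> cols ?\<chi> (f i)"
      using t(1) cols_mono unfolding grows_def by blast
    ultimately show ?thesis by blast
  qed
  ultimately show ?case by blast
qed

lemma makes_insert:
  assumes \<kappa>: "\<kappa> = \<Delta> + c" "c < \<Delta>" and t: "t \<in> {1..\<kappa>}" and X: "card X < \<Delta>"
    and m: "makes \<Delta> \<kappa> (\<lambda>C. C = X) M"
  shows "\<exists>M'. makes \<Delta> \<kappa> (\<lambda>C. C = insert t X) M'"
proof -
  define k where "k = \<Delta> - 1 - card X"
  have Xk: "card X + k = \<Delta> - 1" "card X + k \<le> \<Delta>" using X unfolding k_def by auto
  have k\<Delta>: "\<Delta> \<le> \<kappa>" using \<kappa> by simp
  note mp = makes_pad[OF m Xk(2) k\<Delta>, unfolded Xk(1)]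
  \<comment> \<open>There are \<open>2 ^ \<kappa>\<close> possible color sets, so among
    \<open>N\<close> vertices some set occurs more than \<open>c\<close> times. The additional
    scratch vertex in the bound below is the center \<open>w\<close> of the joins.\<close>
  define N where "N = Suc (2 ^ \<kappa> * c)"
  have "makes \<Delta> \<kappa> (\<lambda>C. insert t X \<subseteq> C) (Suc (N * (M + k)))"
    unfolding makes_def
  proof (intro allI impI)
    fix n A \<chi> S
    assume g: "greedy_rule n \<Delta> \<kappa> A" and v: "valid_state n \<Delta> \<kappa> \<chi>"
      and S: "S \<subseteq> isolated n \<chi>" "Suc (N * (M + k)) \<le> card S"
    then obtain w where w: "w \<in> S" by fastforce
    have fin: "finite S" using S(1) finite_isolated finite_subset by blast
    have c': "N * (M + k) \<le> card (S - {w})" using S(2) w fin by simp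
    have S': "S - {w} \<subseteq> isolated n \<chi>" using S(1) by blast
    obtain \<chi>1 f W where gr: "grows n \<Delta> A \<chi> \<chi>1 (S - {w})"
      and P': "\<forall>i<N. (X \<subseteq> cols \<chi>1 (f i) \<and> card (cols \<chi>1 (f i)) = \<Delta> - 1) \<and> f i \<in> W i \<and>
        W i \<subseteq> S - {w} \<and> closed_in (dom \<chi>1) (W i)"
      and dj: "\<forall>i<N. \<forall>j<N. i \<noteq> j \<longrightarrow> W i \<inter> W j = {}"
      using makes_many[OF mp g v S' c'] by (elim exE conjE)
    note P = P'[rule_format]
    have v1: "valid_state n \<Delta> \<kappa> \<chi>1" using grows_valid[OF gr g v] .
    have "(\<lambda>i. cols \<chi>1 (f i)) ` {..<N} \<subseteq> Pow {1..\<kappa>}"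
      using v1 cols_subset unfolding valid_state_def by blast
    moreover have "card (Pow {1..\<kappa>}) * c < card {..<N}"
      unfolding N_def by (simp add: card_Pow)
    ultimately obtain X' where X': "X' \<in> Pow {1..\<kappa>}" "c < card {i \<in> {..<N}. cols \<chi>1 (f i) = X'}"
      using pigeonhole_fibre[of "Pow {1..\<kappa>}" "\<lambda>i. cols \<chi>1 (f i)" "{..<N}" c] by auto
    then obtain J where J: "J \<subseteq> {i \<in> {..<N}. cols \<chi>1 (f i) = X'}" "card J = Suc c" "finite J"
      by (meson Suc_leI obtain_subset_with_card_n)
    then have JP: "j < N" "cols \<chi>1 (f j) = X'" if "j \<in> J" for j
      using that by auto
    obtain j0 where j0: "j0 \<in> J" using J(2) by fastforce
    have cX': "card X' = \<Delta> - 1" "X \<subseteq> X'"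
      using P[OF JP(1)[OF j0]] JP(2)[OF j0] by auto
    have fX': "finite X'" using X'(1) finite_subset by auto
    have wf: "w \<in> isolated n \<chi>1" using grows_isolated[OF gr] w S(1) by blast
    have Sn: "S \<subseteq> {..<n}" using S(1) unfolding isolated_def by auto
    have "\<exists>\<chi>'. grows n \<Delta> A \<chi>1 \<chi>' (insert w (f ` J)) \<and> card (cols \<chi>' w) = card J \<and>
      cols \<chi>' w \<subseteq> {1..\<kappa>} - X' \<and> (\<forall>a\<in>cols \<chi>' w. \<exists>j\<in>J. insert a X' \<subseteq> cols \<chi>' (f j))"
    proof (rule grows_join[OF g v1 \<kappa> wf _ _ cX'(1) fX' J(3), of W])
      show "closed_in (dom \<chi>1) (W j) \<and> f j \<in> W j \<and> W j \<subseteq> {..<n} \<and> cols \<chi>1 (f j) = X' \<and> w \<notin> W j"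
        if "j \<in> J" for j
        using P[OF JP(1)[OF that]] JP(2)[OF that] Sn by blast
      show "W i \<inter> W j = {}" if "i \<in> J" "j \<in> J" "i \<noteq> j" for i j
        using dj JP(1) that by blast
    qed (use J in simp)
    then obtain \<chi>' where gr': "grows n \<Delta> A \<chi>1 \<chi>' (insert w (f ` J))"
      and cw: "card (cols \<chi>' w) = Suc c" "cols \<chi>' w \<subseteq> {1..\<kappa>} - X'"
      and ex: "\<And>a. a \<in> cols \<chi>' w \<Longrightarrow> \<exists>j\<in>J. insert a X' \<subseteq> cols \<chi>' (f j)"
      using J(2) by auto
    have "card ({1..\<kappa>} - X') = Suc c"
      using X'(1) cX' fX' \<kappa> by (simp add: card_Diff_subset)
    then have all: "cols \<chi>' w = {1..\<kappa>} - X'"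
      using cw by (simp add: card_subset_eq)
    have "\<exists>j\<in>J. insert t X' \<subseteq> cols \<chi>' (f j)"
    proof (cases "t \<in> X'")
      case True
      have "cols \<chi>1 (f j0) \<subseteq> cols \<chi>' (f j0)"
        using gr' cols_mono unfolding grows_def by blast
      then show ?thesis using True j0 JP(2)[OF j0] by blast
    next
      case False
      then show ?thesis using ex all t by blast
    qed
    then obtain j where j: "j \<in> J" "insert t X' \<subseteq> cols \<chi>' (f j)" by blast
    have fS: "f i \<in> S" if "i \<in> J" for i using P[OF JP(1)[OF that]] by blast
    have "grows n \<Delta> A \<chi> \<chi>' S"
      by (rule grows_trans[OF grows_mono[OF gr] grows_mono[OF gr']]) (use w fS in auto)
    then show "\<exists>\<chi>' z. z \<in> S \<and> grows n \<Delta> A \<chi> \<chi>' S \<and> insert t X \<subseteq> cols \<chi>' z"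
      using j cX' fS by blast
  qed
  then show ?thesis using makes_trim by blast
qed

lemma makes_exists:
  assumes \<kappa>: "\<kappa> = \<Delta> + c" "c < \<Delta>" and Y: "finite Y" "Y \<subseteq> {1..\<kappa>}" "card Y \<le> \<Delta>"
  shows "\<exists>M. makes \<Delta> \<kappa> (\<lambda>C. C = Y) M"
  using Y
proof (induction Y rule: finite_induct)
  case empty
  have "makes \<Delta> \<kappa> (\<lambda>C. C = {}) 1"
    unfolding makes_def
  proof (intro allI impI)
    fix n :: nat and A :: "coloring \<Rightarrow> edge \<Rightarrow> coloring" and \<chi> S
    assume S: "S \<subseteq> isolated n \<chi>" "1 \<le> card S"
    then obtain z where z: "z \<in> S" by fastforce
    then have "cols \<chi> z = {}" using isolated_cols S by blast
    then show "\<exists>\<chi>' z. z \<in> S \<and> grows n \<Delta> A \<chi> \<chi>' S \<and> cols \<chi>' z = {}"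
      using z grows_refl by blast
  qed
  then show ?case by blast
next
  case (insert t X)
  then have "card X < \<Delta>" by simp
  with insert show ?case using makes_insert[OF \<kappa>, of t X] by auto
qed

text \<open>There are finitely many color sets, and the sum of their individual thresholds serves
  all of them.\<close>

lemma makes_all:
  assumes \<kappa>: "\<kappa> = \<Delta> + c" "c < \<Delta>"
  shows "\<exists>M. \<forall>Y. Y \<subseteq> {1..\<kappa>} \<and> card Y \<le> \<Delta> \<longrightarrow> makes \<Delta> \<kappa> (\<lambda>C. C = Y) M"
proof -
  let ?B = "{Y. Y \<subseteq> {1..\<kappa>} \<and> card Y \<le> \<Delta>}"
  have "\<forall>Y\<in>?B. \<exists>M. makes \<Delta> \<kappa> (\<lambda>C. C = Y) M"
    using makes_exists[OF \<kappa>] finite_subset[of _ "{1..\<kappa>}"] by blast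
  then obtain F where F: "\<forall>Y\<in>?B. makes \<Delta> \<kappa> (\<lambda>C. C = Y) (F Y)"
    by (rule bchoice[THEN exE])
  have fin: "finite ?B" by simp
  have "makes \<Delta> \<kappa> (\<lambda>C. C = Y) (sum F ?B)" if Y: "Y \<in> ?B" for Y
  proof (rule makes_mono)
    show "makes \<Delta> \<kappa> (\<lambda>C. C = Y) (F Y)" using F Y by (rule bspec)
    show "F Y \<le> sum F ?B" using Y _ fin by (rule member_le_sum) simp
  qed
  then show ?thesis by (intro exI[of _ "sum F ?B"] allI impI) (drule meta_spec, erule meta_mp, simp)
qed

text \<open>The other end of the new edge sees exactly the colors missing at \<open>u\<close> other than \<open>t\<close>,
  so \<open>t\<close> is the only color left.\<close>

lemma add_pendant_color:
  assumes \<kappa>: "\<kappa> = \<Delta> + c" "c < \<Delta>"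
    and m: "\<forall>Y. Y \<subseteq> {1..\<kappa>} \<and> card Y \<le> \<Delta> \<longrightarrow> makes \<Delta> \<kappa> (\<lambda>C. C = Y) M"
    and g: "greedy_rule n \<Delta> \<kappa> A" and v: "valid_state n \<Delta> \<kappa> \<chi>"
    and u: "u < n" "u \<notin> S" and S: "S \<subseteq> isolated n \<chi>" "M + \<Delta> \<le> card S"
    and t: "t \<in> {1..\<kappa>}" "t \<notin> cols \<chi> u" and d: "card (cols \<chi> u) < \<Delta>"
  shows "\<exists>y\<in>S. (moves n \<Delta> A)\<^sup>*\<^sup>* \<chi> (\<chi>({u, y} \<mapsto> t))"
proof -
  have fin: "finite S" using S(1) finite_isolated finite_subset by blast
  have k\<Delta>: "\<Delta> \<le> \<kappa>" using \<kappa> by simp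
  obtain S1 where S1: "S1 \<subseteq> S" "card S1 = M" "finite S1"
    using S(2) by (meson add_leE obtain_subset_with_card_n)
  have "card (S - S1) \<ge> \<Delta>" using S(2) S1 by (simp add: card_Diff_subset)
  then have "\<Delta> - 1 - card (cols \<chi> u) \<le> card (S - S1)" by simp
  moreover have "S - S1 \<subseteq> isolated n \<chi>" using S(1) by blast
  moreover have "card (cols \<chi> u) + (\<Delta> - 1 - card (cols \<chi> u)) \<le> \<Delta>" using d by simp
  ultimately obtain \<chi>1 where gr: "grows n \<Delta> A \<chi> \<chi>1 (insert u (S - S1))"
    and c1: "card (cols \<chi>1 u) = \<Delta> - 1"
    using grows_pad[OF g v k\<Delta> u(1), of "S - S1" "\<Delta> - 1 - card (cols \<chi> u)"] S(1) u(2) d by auto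
  have v1: "valid_state n \<Delta> \<kappa> \<chi>1" using grows_valid[OF gr g v] .
  have "\<exists>\<chi>2 y. y \<in> S \<and> grows n \<Delta> A \<chi> \<chi>2 (insert u S) \<and> \<chi>2 {u, y} = Some t"
  \<comment> \<open>The padding colors are chosen by the rule. If \<open>t\<close> happens to be
    among them, the padding edge of that color is already the required one.\<close>
  proof (cases "t \<in> cols \<chi>1 u")
    case True
    then obtain e where e: "\<chi>1 e = Some t" "u \<in> e" unfolding cols_def by blast
    have new: "e \<notin> dom \<chi>"
    proof
      assume "e \<in> dom \<chi>"
      then have "\<chi> e = Some t" using e(1) gr unfolding grows_def map_le_def by metis
      then show False using t(2) e(2) unfolding cols_def by blast
    qed
    moreover have ed: "e \<in> dom \<chi>1" using e(1) by blast
    ultimately have "e \<subseteq> insert u (S - S1)" using gr unfolding grows_def by blast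
    moreover have "card e = 2" using valid_edge(2)[OF v1 ed] .
    then obtain y where "e = {u, y}" "y \<noteq> u" using e(2) by (auto simp: card_2_iff)
    moreover have "grows n \<Delta> A \<chi> \<chi>1 (insert u S)"
      by (rule grows_mono[OF gr]) auto
    ultimately show ?thesis using e(1) by blast
  next
    case False
    define V where "V = {1..\<kappa>} - {t} - cols \<chi>1 u"
    have cs: "cols \<chi>1 u \<subseteq> {1..\<kappa>}" using v1 cols_subset unfolding valid_state_def by blast
    have "card V = \<kappa> - 1 - (\<Delta> - 1)"
      unfolding V_def using cs False t(1) c1 finite_cols[OF v1]
      by (subst card_Diff_subset) auto
    \<comment> \<open>As \<open>c < \<Delta>\<close>, a vertex \<open>z\<close> with color set
      \<open>V\<close> still has room for the edge to \<open>u\<close>.\<close>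
    then have cV: "card V = c" using \<kappa> by simp
    have S1f: "S1 \<subseteq> isolated n \<chi>1"
      using grows_isolated[OF gr] S(1) S1(1) u(2) by blast
    have "V \<subseteq> {1..\<kappa>}" "card V \<le> \<Delta>" using cV \<kappa> unfolding V_def by auto
    then have "makes \<Delta> \<kappa> (\<lambda>C. C = V) M" using m by blast
    then have "\<exists>\<chi>2 z. z \<in> S1 \<and> grows n \<Delta> A \<chi>1 \<chi>2 S1 \<and> cols \<chi>2 z = V"
      using g v1 S1f S1(2) unfolding makes_def by simp
    then obtain \<chi>2 z where z: "z \<in> S1" and gr2: "grows n \<Delta> A \<chi>1 \<chi>2 S1" and cz: "cols \<chi>2 z = V"
      by blast
    have v2: "valid_state n \<Delta> \<kappa> \<chi>2" using grows_valid[OF gr2 g v1] .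
    have uS1: "u \<notin> S1" using u(2) S1(1) by blast
    have cu: "cols \<chi>2 u = cols \<chi>1 u" using grows_cols[OF gr2 uS1] .
    have ns: "\<not> same_tree (dom \<chi>2) u z"
      using closed_not_same_tree[OF grows_closed[OF gr2 isolated_closed[OF S1f]] uS1 z] by blast
    have un: "cols \<chi>2 u \<union> cols \<chi>2 z = {1..\<kappa>} - {t}"
      unfolding cu cz V_def using cs False by blast
    have zn: "z < n" using z S1f unfolding isolated_def by blast
    have "card (cols \<chi>2 u) < \<Delta>" "card (cols \<chi>2 z) < \<Delta>" "card (cols \<chi>2 u \<union> cols \<chi>2 z) < \<kappa>"
      using cu c1 cz cV \<kappa> un t(1) by auto
    from grows_insert[OF g v2 u(1) zn ns this] obtain s where
      s: "grows n \<Delta> A \<chi>2 (\<chi>2({u, z} \<mapsto> s)) {u, z}" "s \<in> {1..\<kappa>}" "s \<notin> cols \<chi>2 u" "s \<notin> cols \<chi>2 z" .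
    then have st: "s = t" using un by blast
    have "grows n \<Delta> A \<chi> (\<chi>2({u, z} \<mapsto> s)) (insert u S)"
      by (rule grows_trans[OF grows_trans[OF grows_mono[OF gr] grows_mono[OF gr2]] grows_mono[OF s(1)]])
        (use S1 z in auto)
    then show ?thesis using st z S1(1) by (intro exI[of _ "\<chi>2({u, z} \<mapsto> s)"] exI[of _ z]) auto
  qed
  then obtain \<chi>2 y where y: "y \<in> S" and gr2: "grows n \<Delta> A \<chi> \<chi>2 (insert u S)"
    and e: "\<chi>2 {u, y} = Some t" by blast
  have "\<chi>({u, y} \<mapsto> t) \<subseteq>\<^sub>m \<chi>2"
    using gr2 e unfolding grows_def map_le_def by auto
  then have "(moves n \<Delta> A)\<^sup>*\<^sup>* \<chi>2 (\<chi>({u, y} \<mapsto> t))"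
    using moves_trim[OF grows_valid[OF gr2 g v]] by blast
  then show ?thesis
    using y gr2 unfolding grows_def by (meson rtranclp_trans)
qed

text \<open>\<open>add_pendant_color\<close> ends in a coloring with just one more edge, so its
  scratch vertices are isolated again and can be reused. Each color uses up only one vertex of
  \<open>S\<close>, its leaf.\<close>

lemma add_pendant_colors:
  assumes \<kappa>: "\<kappa> = \<Delta> + c" "c < \<Delta>"
    and m: "\<forall>Y. Y \<subseteq> {1..\<kappa>} \<and> card Y \<le> \<Delta> \<longrightarrow> makes \<Delta> \<kappa> (\<lambda>C. C = Y) M"
    and g: "greedy_rule n \<Delta> \<kappa> A" and u: "u < n" and T: "finite T"
  shows "u \<notin> S \<Longrightarrow> S \<subseteq> isolated n \<chi> \<Longrightarrow> M + \<Delta> + card T \<le> card S \<Longrightarrow> T \<inter> cols \<chi> u = {} \<Longrightarrow>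
    card (cols \<chi> u) + card T \<le> \<Delta> \<Longrightarrow> valid_state n \<Delta> \<kappa> \<chi> \<Longrightarrow> T \<subseteq> {1..\<kappa>} \<Longrightarrow>
    \<exists>\<chi>'. grows n \<Delta> A \<chi> \<chi>' (insert u S) \<and> cols \<chi>' u = cols \<chi> u \<union> T"
  using T
proof (induction T arbitrary: \<chi> S rule: finite_induct)
  case empty
  then show ?case using grows_refl by (intro exI[of _ \<chi>]) simp
next
  case (insert t T)
  have fin: "finite S" using insert.prems(2) finite_isolated finite_subset by blast
  have lt: "card (cols \<chi> u) < \<Delta>" using insert.prems(5) insert.hyps by simp
  have "M + \<Delta> \<le> card S" using insert.prems(3) by simp
  then obtain y where y: "y \<in> S" and mv: "(moves n \<Delta> A)\<^sup>*\<^sup>* \<chi> (\<chi>({u, y} \<mapsto> t))"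
    using add_pendant_color[OF \<kappa> m g insert.prems(6) u insert.prems(1,2) _ _ _ lt, of t]
      insert.prems(4,7) by auto
  let ?\<chi> = "\<chi>({u, y} \<mapsto> t)"
  have new: "{u, y} \<notin> dom \<chi>"
    using y insert.prems(2) unfolding isolated_def by blast
  have gr: "grows n \<Delta> A \<chi> ?\<chi> {u, y}"
    using mv map_le_upd_new[OF new] unfolding grows_def by auto
  have cu: "cols ?\<chi> u = insert t (cols \<chi> u)" using cols_upd[OF new] by simp
  have v1: "valid_state n \<Delta> \<kappa> ?\<chi>" using grows_valid[OF gr g insert.prems(6)] .
  have "card (cols ?\<chi> u) = Suc (card (cols \<chi> u))"
    using cu insert.prems(4) finite_cols[OF insert.prems(6)] by simp
  then have c5: "card (cols ?\<chi> u) + card T \<le> \<Delta>" using insert.prems(5) insert.hyps by simp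
  have f: "S - {y} \<subseteq> isolated n ?\<chi>" using grows_isolated[OF gr] insert.prems(1,2) by blast
  have c3: "M + \<Delta> + card T \<le> card (S - {y})" using insert.prems(3) insert.hyps y fin by simp
  have dj: "T \<inter> cols ?\<chi> u = {}" using cu insert.prems(4) insert.hyps by auto
  have "u \<notin> S - {y}" "T \<subseteq> {1..\<kappa>}" using insert.prems(1,7) by auto
  then obtain \<chi>' where x: "grows n \<Delta> A ?\<chi> \<chi>' (insert u (S - {y}))" "cols \<chi>' u = cols ?\<chi> u \<union> T"
    using insert.IH[OF _ f c3 dj c5 v1] by blast
  have "grows n \<Delta> A \<chi> \<chi>' (insert u S)"
    by (rule grows_trans[OF grows_mono[OF gr] grows_mono[OF x(1)]]) (use y in auto)
  then show ?case using x(2) cu by auto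
qed

text \<open>Here both ends are prescribed, so a padding edge that accidentally receives color
  \<open>t\<close> would be of no use. Hence \<open>u\<close> is filled up to
  \<open>\<Delta> - 1\<close> colors with a chosen set \<open>T\<close> that avoids
  \<open>t\<close>, and \<open>w\<close> gets the set \<open>V\<close> of all other colors except
  \<open>t\<close>. The edge between them can then only take \<open>t\<close>, and the auxiliary
  edges are deleted.\<close>

lemma add_pendant_edge:
  assumes \<kappa>: "\<kappa> = \<Delta> + c" "c < \<Delta>"
    and m: "\<forall>Y. Y \<subseteq> {1..\<kappa>} \<and> card Y \<le> \<Delta> \<longrightarrow> makes \<Delta> \<kappa> (\<lambda>C. C = Y) M"
    and g: "greedy_rule n \<Delta> \<kappa> A" and v: "valid_state n \<Delta> \<kappa> \<chi>"
    and u: "u < n" "u \<noteq> w" "u \<notin> S" and w: "w \<in> isolated n \<chi>" "w \<notin> S"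
    and S: "S \<subseteq> isolated n \<chi>" "2 * (M + 2 * \<Delta>) \<le> card S"
    and t: "t \<in> {1..\<kappa>}" "t \<notin> cols \<chi> u" and d: "card (cols \<chi> u) < \<Delta>"
  shows "(moves n \<Delta> A)\<^sup>*\<^sup>* \<chi> (\<chi>({u, w} \<mapsto> t))"
proof -
  have cs: "cols \<chi> u \<subseteq> {1..\<kappa>}" using v cols_subset unfolding valid_state_def by blast
  have "card ({1..\<kappa>} - {t} - cols \<chi> u) = \<kappa> - 1 - card (cols \<chi> u)"
    using cs t finite_cols[OF v] by (subst card_Diff_subset) auto
  then have "\<Delta> - 1 - card (cols \<chi> u) \<le> card ({1..\<kappa>} - {t} - cols \<chi> u)"
    using \<kappa> by simp
  then obtain T where T: "T \<subseteq> {1..\<kappa>} - {t} - cols \<chi> u" "card T = \<Delta> - 1 - card (cols \<chi> u)" "finite T"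
    by (meson obtain_subset_with_card_n)
  define V where "V = {1..\<kappa>} - {t} - (cols \<chi> u \<union> T)"
  have cuT: "card (cols \<chi> u \<union> T) = \<Delta> - 1"
    using T d finite_cols[OF v] by (subst card_Un_disjoint) auto
  have "card V = \<kappa> - 1 - (\<Delta> - 1)"
    unfolding V_def using cs t T finite_cols[OF v] cuT by (subst card_Diff_subset) auto
  then have cV: "card V = c" using \<kappa> d by simp
  have fV: "finite V" "V \<subseteq> {1..\<kappa>}" unfolding V_def by auto
  \<comment> \<open>One half of the scratch space prepares \<open>u\<close> and the other prepares
    \<open>w\<close>. Each must supply \<open>M + \<Delta>\<close> vertices and a leaf per color,
    and \<open>T\<close> and \<open>V\<close> have at most \<open>\<Delta>\<close> colors
    each.\<close>
  obtain S1 where S1: "S1 \<subseteq> S" "card S1 = M + 2 * \<Delta>" "finite S1"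
    using S(2) by (metis add_leE mult_2 obtain_subset_with_card_n)
  have cS2: "M + 2 * \<Delta> \<le> card (S - S1)" using S(2) S1 by (simp add: card_Diff_subset)
  have uS1: "u \<notin> S1" "S1 \<subseteq> isolated n \<chi>" "M + \<Delta> + card T \<le> card S1"
    "T \<inter> cols \<chi> u = {}" "card (cols \<chi> u) + card T \<le> \<Delta>" "T \<subseteq> {1..\<kappa>}"
    using u(3) S(1) S1 T d by auto
  obtain \<chi>1 where gr1: "grows n \<Delta> A \<chi> \<chi>1 (insert u S1)" and c1: "cols \<chi>1 u = cols \<chi> u \<union> T"
    using add_pendant_colors[OF \<kappa> m g u(1) T(3) uS1(1-5) v uS1(6)] by blast
  have v1: "valid_state n \<Delta> \<kappa> \<chi>1" using grows_valid[OF gr1 g v] .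
  have wf: "w \<in> isolated n \<chi>1" "S - S1 \<subseteq> isolated n \<chi>1"
    using grows_isolated[OF gr1] w S(1) S1(1) u(2,3) by blast+
  have wn: "w < n" using w(1) unfolding isolated_def by simp
  have wS2: "w \<notin> S - S1" "M + \<Delta> + card V \<le> card (S - S1)" "V \<inter> cols \<chi>1 w = {}"
    "card (cols \<chi>1 w) + card V \<le> \<Delta>"
    using w(2) cS2 cV \<kappa> isolated_cols[OF wf(1)] by auto
  obtain \<chi>2 where gr2: "grows n \<Delta> A \<chi>1 \<chi>2 (insert w (S - S1))" and c2: "cols \<chi>2 w = cols \<chi>1 w \<union> V"
    using add_pendant_colors[OF \<kappa> m g wn fV(1) wS2(1) wf(2) wS2(2-4) v1 fV(2)] by blast
  have v2: "valid_state n \<Delta> \<kappa> \<chi>2" using grows_valid[OF gr2 g v1] .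
  have u2: "u \<notin> insert w (S - S1)" using u by blast
  have cu: "cols \<chi>2 u = cols \<chi> u \<union> T" using grows_cols[OF gr2 u2] c1 by simp
  have cw: "cols \<chi>2 w = V" using c2 isolated_cols[OF wf(1)] by simp
  have "closed_in (dom \<chi>1) (insert w (S - S1))"
    using wf by (intro isolated_closed[of _ n]) auto
  then have "closed_in (dom \<chi>2) (insert w (S - S1))"
    using grows_closed[OF gr2] by blast
  then have ns: "\<not> same_tree (dom \<chi>2) u w"
    using closed_not_same_tree[OF _ u2] by blast
  have un: "cols \<chi>2 u \<union> cols \<chi>2 w = {1..\<kappa>} - {t}"
    unfolding cu cw V_def using cs t T(1) by blast
  have "card (cols \<chi>2 u) < \<Delta>" "card (cols \<chi>2 w) < \<Delta>" "card (cols \<chi>2 u \<union> cols \<chi>2 w) < \<kappa>"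
    unfolding un unfolding cu cw using cuT cV d \<kappa> t(1) by auto
  from grows_insert[OF g v2 u(1) wn ns this] obtain s where
    s: "grows n \<Delta> A \<chi>2 (\<chi>2({u, w} \<mapsto> s)) {u, w}" "s \<in> {1..\<kappa>}" "s \<notin> cols \<chi>2 u" "s \<notin> cols \<chi>2 w" .
  then have st: "s = t" using un by blast
  have gr: "grows n \<Delta> A \<chi> (\<chi>2({u, w} \<mapsto> t)) UNIV"
    by (rule grows_trans[OF grows_trans[OF grows_mono[OF gr1] grows_mono[OF gr2]]
          grows_mono[OF s(1)[unfolded st]]]) auto
  have "\<chi>({u, w} \<mapsto> t) \<subseteq>\<^sub>m \<chi>2({u, w} \<mapsto> t)"
  proof -
    have "\<chi> \<subseteq>\<^sub>m \<chi>2" using gr1 gr2 map_le_trans unfolding grows_def by blast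
    then show ?thesis by (rule map_le_upd)
  qed
  then have "(moves n \<Delta> A)\<^sup>*\<^sup>* (\<chi>2({u, w} \<mapsto> t)) (\<chi>({u, w} \<mapsto> t))"
    using moves_trim[OF grows_valid[OF gr g v]] by blast
  then show ?thesis
    using gr unfolding grows_def by (meson rtranclp_trans)
qed

text \<open>A class of colorings that does not mention the rule. The bad state is built inside it,
  and reachability is shown for the whole class. The vertex \<open>u\<close> may itself be isolated,
  so forests with several trees arise.\<close>

inductive grown :: "nat \<Rightarrow> nat \<Rightarrow> nat \<Rightarrow> coloring \<Rightarrow> bool" for n \<Delta> \<kappa> where
  empty: "grown n \<Delta> \<kappa> Map.empty"
| pendant: "grown n \<Delta> \<kappa> \<chi> \<Longrightarrow> u < n \<Longrightarrow> w \<in> isolated n \<chi> \<Longrightarrow> u \<noteq> w \<Longrightarrow> t \<in> {1..\<kappa>} \<Longrightarrow> t \<notin> cols \<chi> u \<Longrightarrow>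
    card (cols \<chi> u) < \<Delta> \<Longrightarrow> grown n \<Delta> \<kappa> (\<chi>({u, w} \<mapsto> t))"

lemma valid_empty: "valid_state n \<Delta> \<kappa> Map.empty"
proof -
  have "\<not> is_cycle {} vs" for vs
    unfolding is_cycle_def by (cases vs) auto
  then show ?thesis
    unfolding valid_state_def is_forest_def max_degree_le_def proper_coloring_def degree_def by simp
qed

lemma grown_valid: "grown n \<Delta> \<kappa> \<chi> \<Longrightarrow> valid_state n \<Delta> \<kappa> \<chi>"
proof (induction rule: grown.induct)
  case empty
  then show ?case by (rule valid_empty)
next
  case (pendant \<chi> u w t)
  have "\<not> same_tree (dom \<chi>) u w"
    using closed_not_same_tree[OF isolated_closed[of "{w}" n]] pendant.hyps by blast
  moreover have "cols \<chi> w = {}" "w < n"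
    using isolated_cols pendant.hyps(3) unfolding isolated_def by blast+
  ultimately show ?case
    using pendant by (intro valid_insert) auto
qed

text \<open>Isolated vertices only become fewer along the construction. Those left in the final
  coloring are thus available as scratch space in every earlier step, and each step frees them
  again.\<close>

lemma grown_reachable_aux:
  assumes \<kappa>: "\<kappa> = \<Delta> + c" "c < \<Delta>"
    and m: "\<forall>Y. Y \<subseteq> {1..\<kappa>} \<and> card Y \<le> \<Delta> \<longrightarrow> makes \<Delta> \<kappa> (\<lambda>C. C = Y) M"
    and g: "greedy_rule n \<Delta> \<kappa> A"
  shows "grown n \<Delta> \<kappa> \<chi> \<Longrightarrow> 2 * (M + 2 * \<Delta>) \<le> card (isolated n \<chi>) \<Longrightarrow>
    (moves n \<Delta> A)\<^sup>*\<^sup>* Map.empty \<chi>"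
proof (induction rule: grown.induct)
  case empty
  then show ?case by simp
next
  case (pendant \<chi> u w t)
  let ?S = "isolated n (\<chi>({u, w} \<mapsto> t))"
  have new: "{u, w} \<notin> dom \<chi>" using pendant.hyps(3) unfolding isolated_def by blast
  have sub: "?S \<subseteq> isolated n \<chi>" by (rule isolated_sub[OF map_le_upd_new[OF new]])
  have "u \<notin> ?S" "w \<notin> ?S" unfolding isolated_def by auto
  then have "(moves n \<Delta> A)\<^sup>*\<^sup>* \<chi> (\<chi>({u, w} \<mapsto> t))"
    using add_pendant_edge[OF \<kappa> m g grown_valid[OF pendant.hyps(1)] pendant.hyps(2,4) _
        pendant.hyps(3) _ sub pendant.prems pendant.hyps(5-7)] by blast
  moreover have "2 * (M + 2 * \<Delta>) \<le> card (isolated n \<chi>)"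
    using pendant.prems card_mono[OF finite_isolated sub] by linarith
  ultimately show ?case
    using pendant.IH by (meson rtranclp_trans)
qed

lemma grown_reachable:
  assumes "c < \<Delta>"
  shows "\<exists>M. \<forall>n A \<chi>. greedy_rule n \<Delta> (\<Delta> + c) A \<longrightarrow> grown n \<Delta> (\<Delta> + c) \<chi> \<longrightarrow>
    M \<le> card (isolated n \<chi>) \<longrightarrow> reachable n \<Delta> A \<chi>"
  using makes_all[OF refl assms] grown_reachable_aux[OF refl assms] moves_star_reachable by meson

section \<open>Trees that are expensive to recolor\<close>

text \<open>\<open>\<psi>\<close> is meant to be the part of the coloring on a subtree with root \<open>w\<close>, and \<open>e\<close> the edge from \<open>w\<close> to
  its parent.\<close>

definition costly :: "nat \<Rightarrow> coloring \<Rightarrow> nat \<Rightarrow> nat set \<Rightarrow> nat \<Rightarrow> bool" where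
  "costly \<kappa> \<psi> w C d \<longleftrightarrow> (\<forall>\<chi> e. proper_coloring \<kappa> \<chi> \<longrightarrow> dom \<psi> \<subseteq> dom \<chi> \<longrightarrow> e \<in> dom \<chi> - dom \<psi> \<longrightarrow>
     w \<in> e \<longrightarrow> \<chi> e \<in> Some ` C \<longrightarrow> d \<le> card {f \<in> dom \<psi>. \<chi> f \<noteq> \<psi> f})"

text \<open>By \<open>guarded_cost\<close> below, recoloring the edge of color \<open>b\<close> at \<open>w\<close> with a color outside \<open>C\<close> is expensive.\<close>

definition guarded ::
  "nat \<Rightarrow> coloring \<Rightarrow> nat \<Rightarrow> nat set \<Rightarrow> nat set \<Rightarrow> nat \<Rightarrow> nat \<Rightarrow> bool" where
  "guarded \<kappa> \<chi> w S C b d \<longleftrightarrow> (\<exists>y\<in>S. \<exists>\<psi> C'. \<chi> {w, y} = Some b \<and> \<psi> \<subseteq>\<^sub>m \<chi> \<and> dom \<psi> \<subseteq> Pow S \<and>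
     {1..\<kappa>} - C \<subseteq> C' \<and> costly \<kappa> \<psi> y C' d)"

lemma guarded_mono:
  assumes "guarded \<kappa> \<chi> w S C b d" "\<chi> \<subseteq>\<^sub>m \<chi>'" "S \<subseteq> S'"
  shows "guarded \<kappa> \<chi>' w S' C b d"
proof -
  obtain y \<psi> C' where y: "y \<in> S" "\<chi> {w, y} = Some b" "\<psi> \<subseteq>\<^sub>m \<chi>" "dom \<psi> \<subseteq> Pow S"
    "{1..\<kappa>} - C \<subseteq> C'" "costly \<kappa> \<psi> y C' d"
    using assms(1) unfolding guarded_def by blast
  have "\<chi>' {w, y} = Some b"
    using y(2) assms(2) unfolding map_le_def by (metis domI)
  moreover have "\<psi> \<subseteq>\<^sub>m \<chi>'" using y(3) assms(2) map_le_trans by blast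
  moreover have "dom \<psi> \<subseteq> Pow S'" using y(4) assms(3) by blast
  ultimately show ?thesis
    using y assms(3) unfolding guarded_def by blast
qed

text \<open>If the guarded edge left \<open>C\<close>, its new color would lie in \<open>C'\<close>
  and force \<open>d\<close> changes inside \<open>\<psi>\<close>. The edge itself is one more
  change, which exceeds the budget \<open>d\<close>.\<close>

lemma guarded_cost:
  assumes G: "guarded \<kappa> \<chi> w S C b d" and w: "w \<notin> S" and b: "b \<in> C" and fin: "finite (dom \<chi>)"
    and p: "proper_coloring \<kappa> \<chi>'" and d: "dom \<chi> \<subseteq> dom \<chi>'"
    and cheap: "card {f \<in> dom \<chi>. \<chi>' f \<noteq> \<chi> f} \<le> d"
  obtains y where "y \<in> S" "\<chi> {w, y} = Some b" "\<chi>' {w, y} \<in> Some ` C"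
proof -
  obtain y \<psi> C' where y: "y \<in> S" "\<chi> {w, y} = Some b" "\<psi> \<subseteq>\<^sub>m \<chi>" "dom \<psi> \<subseteq> Pow S"
    "{1..\<kappa>} - C \<subseteq> C'" "costly \<kappa> \<psi> y C' d"
    using G unfolding guarded_def by blast
  have e: "{w, y} \<in> dom \<chi>" "{w, y} \<notin> dom \<psi>" using y(2,4) w by auto
  then obtain a where a: "\<chi>' {w, y} = Some a" using d by blast
  have "a \<in> C"
  proof (rule ccontr)
    assume na: "a \<notin> C"
    have "a \<in> {1..\<kappa>}" using p a unfolding proper_coloring_def by (blast intro: ranI)
    then have "\<chi>' {w, y} \<in> Some ` C'" using a na y(5) by blast
    moreover have dd: "dom \<psi> \<subseteq> dom \<chi>" using y(3) by (rule map_le_implies_dom_le)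
    ultimately have "d \<le> card {f \<in> dom \<psi>. \<chi>' f \<noteq> \<psi> f}"
      using y(6) p d e unfolding costly_def by blast
    moreover have "insert {w, y} {f \<in> dom \<psi>. \<chi>' f \<noteq> \<psi> f} \<subseteq> {f \<in> dom \<chi>. \<chi>' f \<noteq> \<chi> f}"
    proof (rule insert_subsetI)
      show "{w, y} \<in> {f \<in> dom \<chi>. \<chi>' f \<noteq> \<chi> f}" using e(1) a y(2) na b by auto
      show "{f \<in> dom \<psi>. \<chi>' f \<noteq> \<psi> f} \<subseteq> {f \<in> dom \<chi>. \<chi>' f \<noteq> \<chi> f}"
        using dd y(3) unfolding map_le_def by (auto dest!: bspec)
    qed
    then have "card (insert {w, y} {f \<in> dom \<psi>. \<chi>' f \<noteq> \<psi> f}) \<le> card {f \<in> dom \<chi>. \<chi>' f \<noteq> \<chi> f}"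
      using fin by (intro card_mono) auto
    moreover have "finite (dom \<psi>)" using dd fin finite_subset by blast
    ultimately show False using e(2) cheap by simp
  qed
  then show ?thesis using that y a by blast
qed

text \<open>The edge \<open>e\<close> takes a color of \<open>C\<close> away from the guarded edges at \<open>w\<close>, so one of these has to
  leave \<open>C\<close>.\<close>

lemma costly_Suc:
  assumes G: "\<And>b. b \<in> C \<Longrightarrow> guarded \<kappa> \<chi> w S C b d" and w: "w \<notin> S"
    and fin: "finite (dom \<chi>)" "finite C"
  shows "costly \<kappa> \<chi> w C (Suc d)"
  unfolding costly_def
proof (intro allI impI, rule ccontr)
  fix \<chi>' e
  assume p: "proper_coloring \<kappa> \<chi>'" and d: "dom \<chi> \<subseteq> dom \<chi>'" and e: "e \<in> dom \<chi>' - dom \<chi>" "w \<in> e"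
    and eC: "\<chi>' e \<in> Some ` C" and "\<not> Suc d \<le> card {f \<in> dom \<chi>. \<chi>' f \<noteq> \<chi> f}"
  then have cheap: "card {f \<in> dom \<chi>. \<chi>' f \<noteq> \<chi> f} \<le> d" by simp
  obtain a where a: "\<chi>' e = Some a" "a \<in> C" using eC by blast
  have "\<exists>y. \<chi> {w, y} = Some b \<and> \<chi>' {w, y} \<in> Some ` C" if "b \<in> C" for b
    using guarded_cost[OF G[OF that] w that fin(1) p d cheap] by metis
  then have "\<forall>b\<in>C. \<exists>y. \<chi> {w, y} = Some b \<and> \<chi>' {w, y} \<in> Some ` C" by blast
  then obtain y where "\<forall>b\<in>C. \<chi> {w, y b} = Some b \<and> \<chi>' {w, y b} \<in> Some ` C"
    by (rule bchoice[THEN exE])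
  note y = this[rule_format]
  let ?g = "\<lambda>b. the (\<chi>' {w, y b})"
  have g: "\<chi>' {w, y b} = Some (?g b)" "?g b \<in> C" if "b \<in> C" for b
    using y[OF that] by auto
  have "inj_on ?g C"
  proof (rule inj_onI)
    fix b b' assume bb: "b \<in> C" "b' \<in> C" "?g b = ?g b'"
    then have "{w, y b} = {w, y b'}"
      using proper_same[OF p g(1)[OF bb(1)], of "{w, y b'}" w] g(1)[OF bb(2)] bb(3) by simp
    then show "b = b'" using y bb by (metis option.inject)
  qed
  moreover have "?g ` C \<subseteq> C - {a}"
  proof
    fix x assume "x \<in> ?g ` C"
    then obtain b where b: "b \<in> C" "x = ?g b" by blast
    have "x \<noteq> a"
    proof
      assume "x = a"
      then have "{w, y b} = e"
        using proper_same[OF p g(1)[OF b(1)], of e w] b(2) a(1) e(2) by simp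
      then show False using y[OF b(1)] e(1) by auto
    qed
    then show "x \<in> C - {a}" using g(2)[OF b(1)] b(2) by blast
  qed
  ultimately have "card C \<le> card (C - {a})"
    using fin(2) by (meson card_inj_on_le finite_Diff)
  then show False using a(2) fin(2) by (metis card_Diff1_less linorder_not_le)
qed

text \<open>\<open>\<Delta> ^ d - 1\<close> bounds the number of vertices below the root: each of
  \<open>\<Delta> - 1\<close> children takes up to \<open>\<Delta> ^ d\<close> vertices including
  itself, and \<open>(\<Delta> - 1) * \<Delta> ^ d \<le> \<Delta> ^ Suc d - 1\<close>. The single
  color permitted at \<open>w\<close> is that of a parent edge.\<close>

definition plantable :: "nat \<Rightarrow> nat \<Rightarrow> nat \<Rightarrow> nat \<Rightarrow> bool" where
  "plantable n \<Delta> \<kappa> d \<longleftrightarrow> (\<forall>\<chi> w S C. grown n \<Delta> \<kappa> \<chi> \<longrightarrow> w < n \<longrightarrow> w \<notin> S \<longrightarrow> S \<subseteq> isolated n \<chi> \<longrightarrow>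
     \<Delta> ^ d - 1 \<le> card S \<longrightarrow> C \<subseteq> {1..\<kappa>} \<longrightarrow> card C = \<Delta> - 1 \<longrightarrow> cols \<chi> w \<inter> C = {} \<longrightarrow>
     card (cols \<chi> w) \<le> 1 \<longrightarrow>
     (\<exists>\<chi>'. grown n \<Delta> \<kappa> \<chi>' \<and> \<chi> \<subseteq>\<^sub>m \<chi>' \<and>
       (\<forall>e\<in>dom \<chi>' - dom \<chi>. e \<subseteq> insert w S \<and> (w \<in> e \<longrightarrow> \<chi>' e \<in> Some ` C)) \<and>
       costly \<kappa> (\<chi>' |` (dom \<chi>' - dom \<chi>)) w C d))"

text \<open>This is where trees need \<open>c \<le> \<Delta> - 2\<close>: the \<open>c + 1\<close>
  colors outside \<open>C\<close> must be among the \<open>\<Delta> - 1\<close> child colors of the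
  next level. The color \<open>b\<close> of the connecting edge can be avoided there because it lies
  in \<open>C\<close>.\<close>

lemma obtain_color_set:
  assumes \<kappa>: "\<kappa> = \<Delta> + c" "c + 2 \<le> \<Delta>" and C: "C \<subseteq> {1..\<kappa>}" "card C = \<Delta> - 1" and b: "b \<in> C"
  obtains C' where "{1..\<kappa>} - C \<subseteq> C'" "C' \<subseteq> {1..\<kappa>}" "card C' = \<Delta> - 1" "b \<notin> C'"
proof -
  have fC: "finite C" using C(1) finite_subset by auto
  have "card ({1..\<kappa>} - C) \<le> \<Delta> - 1"
    using C \<kappa> fC by (simp add: card_Diff_subset)
  moreover have "\<Delta> - 1 \<le> card ({1..\<kappa>} - {b})"
    using \<kappa> b C(1) by (subst card_Diff_singleton) auto
  ultimately obtain C' where "{1..\<kappa>} - C \<subseteq> C'" "C' \<subseteq> {1..\<kappa>} - {b}" "card C' = \<Delta> - 1"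
    using exists_subset_between[of "{1..\<kappa>} - C" "\<Delta> - 1" "{1..\<kappa>} - {b}"] b by auto
  then show ?thesis using that by blast
qed

text \<open>\<open>B\<close> is kept apart from \<open>C\<close> for two reasons: the induction
  plants one color at a time, and at a path vertex the color \<open>alt i\<close> belongs to the
  guarding set but is not planted. Each color consumes \<open>\<Delta> ^ d\<close> vertices, the
  child and the tree below it.\<close>

lemma plant_guarded:
  assumes P: "plantable n \<Delta> \<kappa> d" and \<kappa>: "\<kappa> = \<Delta> + c" "c + 2 \<le> \<Delta>"
    and C: "C \<subseteq> {1..\<kappa>}" "card C = \<Delta> - 1" and w: "w < n" and B: "finite B"
  shows "B \<subseteq> C \<Longrightarrow> grown n \<Delta> \<kappa> \<chi> \<Longrightarrow> w \<notin> S \<Longrightarrow> S \<subseteq> isolated n \<chi> \<Longrightarrow> card B * \<Delta> ^ d \<le> card S \<Longrightarrow>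
    B \<inter> cols \<chi> w = {} \<Longrightarrow> card (cols \<chi> w) + card B \<le> \<Delta> \<Longrightarrow>
    \<exists>\<chi>'. grown n \<Delta> \<kappa> \<chi>' \<and> \<chi> \<subseteq>\<^sub>m \<chi>' \<and>
      (\<forall>e\<in>dom \<chi>' - dom \<chi>. e \<subseteq> insert w S \<and> (w \<in> e \<longrightarrow> \<chi>' e \<in> Some ` B)) \<and>
      (\<forall>b\<in>B. guarded \<kappa> \<chi>' w S C b d)"
  using B
proof (induction B arbitrary: \<chi> S rule: finite_induct)
  case empty
  then show ?case by (intro exI[of _ \<chi>]) simp
next
  case (insert b B)
  have fin: "finite S" using insert.prems(4) finite_isolated finite_subset by blast
  have pos: "1 \<le> \<Delta> ^ d" using \<kappa> by simp
  have cS: "card B * \<Delta> ^ d + \<Delta> ^ d \<le> card S" using insert.prems(5) insert.hyps by simp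
  obtain S1 where S1: "S1 \<subseteq> S" "card S1 = \<Delta> ^ d" "finite S1"
    using cS by (meson add_leE obtain_subset_with_card_n)
  then have "S1 \<noteq> {}" using pos card.empty by (metis not_one_le_zero)
  then obtain y where y: "y \<in> S1" by blast
  let ?\<chi>1 = "\<chi>({w, y} \<mapsto> b)"
  have yf: "y \<in> isolated n \<chi>" "w \<noteq> y" "y < n"
    using y S1(1) insert.prems(3,4) unfolding isolated_def by blast+
  have new: "{w, y} \<notin> dom \<chi>" using yf(1) unfolding isolated_def by blast
  have bC: "b \<in> C" "b \<in> {1..\<kappa>}" "b \<notin> cols \<chi> w" using insert.prems(1,6) C(1) by auto
  have cw: "card (cols \<chi> w) < \<Delta>" using insert.prems(7) insert.hyps by simp
  have gr1: "grown n \<Delta> \<kappa> ?\<chi>1"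
    using grown.pendant[OF insert.prems(2) w yf(1,2) bC(2,3) cw] .
  obtain C' where C': "{1..\<kappa>} - C \<subseteq> C'" "C' \<subseteq> {1..\<kappa>}" "card C' = \<Delta> - 1" "b \<notin> C'"
    using obtain_color_set[OF \<kappa> C bC(1)] .
  have cy: "cols ?\<chi>1 y = {b}" using cols_upd[OF new] isolated_cols[OF yf(1)] by simp
  have free1: "S - {y} \<subseteq> isolated n ?\<chi>1"
    using insert.prems(3,4) unfolding isolated_def by auto
  have S1': "y \<notin> S1 - {y}" "S1 - {y} \<subseteq> isolated n ?\<chi>1" "\<Delta> ^ d - 1 \<le> card (S1 - {y})"
    using free1 S1 y by auto
  obtain \<chi>2 where gr2: "grown n \<Delta> \<kappa> \<chi>2" and le2: "?\<chi>1 \<subseteq>\<^sub>m \<chi>2"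
    and n2: "\<And>e. e \<in> dom \<chi>2 - dom ?\<chi>1 \<Longrightarrow> e \<subseteq> insert y (S1 - {y})"
    and co: "costly \<kappa> (\<chi>2 |` (dom \<chi>2 - dom ?\<chi>1)) y C' d"
    using P[unfolded plantable_def, rule_format, OF gr1 yf(3) S1' C'(2,3)] cy C'(4) by auto
  have n2': "e \<subseteq> S1" if "e \<in> dom \<chi>2 - dom ?\<chi>1" for e using n2[OF that] y by blast
  have "\<chi>2 |` (dom \<chi>2 - dom ?\<chi>1) \<subseteq>\<^sub>m \<chi>2"
    unfolding map_le_def by auto
  moreover have "\<chi>2 {w, y} = Some b"
    using le2 unfolding map_le_def by auto
  moreover have "dom (\<chi>2 |` (dom \<chi>2 - dom ?\<chi>1)) \<subseteq> Pow S"
  proof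
    fix e assume "e \<in> dom (\<chi>2 |` (dom \<chi>2 - dom ?\<chi>1))"
    then have "e \<in> dom \<chi>2 - dom ?\<chi>1" unfolding dom_restrict by blast
    then show "e \<in> Pow S" using n2' S1(1) by blast
  qed
  ultimately have G2: "guarded \<kappa> \<chi>2 w S C b d"
    unfolding guarded_def using co C'(1) y S1(1) by blast
  have wS1: "w \<notin> S1" using insert.prems(3) S1(1) by blast
  have "cols \<chi>2 w = cols ?\<chi>1 w"
    by (rule cols_extend[OF le2]) (use n2' wS1 in blast)
  then have cw2: "cols \<chi>2 w = insert b (cols \<chi> w)" using cols_upd[OF new] by simp
  have f2: "S - S1 \<subseteq> isolated n \<chi>2"
  proof
    fix x assume x: "x \<in> S - S1"
    then have "x \<in> isolated n ?\<chi>1" using free1 y by blast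
    then show "x \<in> isolated n \<chi>2" using x n2' unfolding isolated_def by blast
  qed
  have le: "\<chi> \<subseteq>\<^sub>m \<chi>2" using map_le_trans[OF map_le_upd_new[OF new] le2] .
  have "card B * \<Delta> ^ d \<le> card (S - S1)" using cS S1 by (simp add: card_Diff_subset)
  moreover have "B \<inter> cols \<chi>2 w = {}" using cw2 insert.prems(6) insert.hyps by auto
  moreover have "card (cols \<chi>2 w) + card B \<le> \<Delta>"
    using cw2 insert.prems(7) insert.hyps bC(3) finite_cols[OF grown_valid[OF insert.prems(2)]] by simp
  moreover have "w \<notin> S - S1" "B \<subseteq> C" using insert.prems(1,3) by auto
  ultimately obtain \<chi>3 where gr3: "grown n \<Delta> \<kappa> \<chi>3" and le3: "\<chi>2 \<subseteq>\<^sub>m \<chi>3"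
    and n3: "\<And>e. e \<in> dom \<chi>3 - dom \<chi>2 \<Longrightarrow> e \<subseteq> insert w (S - S1) \<and> (w \<in> e \<longrightarrow> \<chi>3 e \<in> Some ` B)"
    and G3: "\<And>a. a \<in> B \<Longrightarrow> guarded \<kappa> \<chi>3 w (S - S1) C a d"
    using insert.IH[of \<chi>2 "S - S1"] gr2 f2 by auto
  have "e \<subseteq> insert w S \<and> (w \<in> e \<longrightarrow> \<chi>3 e \<in> Some ` insert b B)" if e: "e \<in> dom \<chi>3 - dom \<chi>" for e
  proof (cases "e \<in> dom \<chi>2")
    case False
    then show ?thesis using n3[of e] e by blast
  next
    case True
    have e3: "\<chi>3 e = \<chi>2 e" using le3 True unfolding map_le_def by auto
    show ?thesis
    proof (cases "e \<in> dom ?\<chi>1")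
      case False
      then show ?thesis using n2'[of e] True S1(1) wS1 by blast
    next
      case e1: True
      then have "e = {w, y}" using e by auto
      then show ?thesis using e3 \<open>\<chi>2 {w, y} = Some b\<close> y S1(1) by auto
    qed
  qed
  moreover have "guarded \<kappa> \<chi>3 w S C a d" if "a \<in> insert b B" for a
    using that guarded_mono[OF G2 le3 subset_refl] guarded_mono[OF G3 map_le_refl] by blast
  ultimately show ?case using gr3 map_le_trans[OF le le3] by blast
qed

lemma plantable:
  assumes \<kappa>: "\<kappa> = \<Delta> + c" "c + 2 \<le> \<Delta>"
  shows "plantable n \<Delta> \<kappa> d"
proof (induction d)
  case 0
  show ?case
    unfolding plantable_def costly_def by (blast intro: map_le_refl)
next
  case (Suc d)
  show ?case
    unfolding plantable_def
  proof (intro allI impI)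
    fix \<chi> w S C
    assume gr: "grown n \<Delta> \<kappa> \<chi>" and w: "w < n" "w \<notin> S" and S: "S \<subseteq> isolated n \<chi>" "\<Delta> ^ Suc d - 1 \<le> card S"
      and C: "C \<subseteq> {1..\<kappa>}" "card C = \<Delta> - 1" and cw: "cols \<chi> w \<inter> C = {}" "card (cols \<chi> w) \<le> 1"
    have fC: "finite C" using C(1) finite_subset by auto
    have "(\<Delta> - 1) * \<Delta> ^ d \<le> \<Delta> ^ Suc d - 1"
      using \<kappa> by (simp add: diff_mult_distrib diff_le_mono2)
    then have cS: "card C * \<Delta> ^ d \<le> card S" using C(2) S(2) by simp
    have cc: "C \<inter> cols \<chi> w = {}" "card (cols \<chi> w) + card C \<le> \<Delta>" using cw C(2) \<kappa> by auto
    obtain \<chi>' where gr': "grown n \<Delta> \<kappa> \<chi>'" and le: "\<chi> \<subseteq>\<^sub>m \<chi>'"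
      and new: "\<forall>e\<in>dom \<chi>' - dom \<chi>. e \<subseteq> insert w S \<and> (w \<in> e \<longrightarrow> \<chi>' e \<in> Some ` C)"
      and G: "\<forall>b\<in>C. guarded \<kappa> \<chi>' w S C b d"
      using plant_guarded[OF Suc.IH \<kappa> C w(1) fC subset_refl gr w(2) S(1) cS cc] by (elim exE conjE)
    let ?\<psi> = "\<chi>' |` (dom \<chi>' - dom \<chi>)"
    \<comment> \<open>Edges inside \<open>S\<close> must be new because \<open>S\<close> was
      isolated. So the guards lie in the new part, and the cost can be claimed for that part
      alone.\<close>
    have out: "e \<notin> dom \<chi>" if eS: "e \<subseteq> S" and ed: "e \<in> dom \<chi>'" for e
    proof
      assume "e \<in> dom \<chi>"
      moreover obtain x where "x \<in> e"
        using valid_edge(2)[OF grown_valid[OF gr'] ed] by fastforce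
      ultimately show False using eS S(1) unfolding isolated_def by blast
    qed
    have "guarded \<kappa> ?\<psi> w S C b d" if b: "b \<in> C" for b
    proof -
      obtain y \<psi> C' where y: "y \<in> S" "\<chi>' {w, y} = Some b" "\<psi> \<subseteq>\<^sub>m \<chi>'" "dom \<psi> \<subseteq> Pow S"
        "{1..\<kappa>} - C \<subseteq> C'" "costly \<kappa> \<psi> y C' d"
        using bspec[OF G b] unfolding guarded_def by blast
      have "{w, y} \<notin> dom \<chi>" using y(1) S(1) unfolding isolated_def by blast
      then have "?\<psi> {w, y} = Some b" using y(2) by (auto simp: restrict_map_def)
      moreover have "e \<in> dom \<chi>' - dom \<chi>" if "e \<in> dom \<psi>" for e
        using out[of e] that y(4) map_le_implies_dom_le[OF y(3)] by blast
      then have "\<psi> \<subseteq>\<^sub>m ?\<psi>"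
        using y(3) unfolding map_le_def by (simp add: restrict_map_def)
      ultimately show ?thesis using y unfolding guarded_def by blast
    qed
    moreover have "finite (dom ?\<psi>)"
      using valid_finite[OF grown_valid[OF gr']] by simp
    ultimately have "costly \<kappa> ?\<psi> w C (Suc d)"
      using w(2) fC by (intro costly_Suc)
    then show "\<exists>\<chi>'. grown n \<Delta> \<kappa> \<chi>' \<and> \<chi> \<subseteq>\<^sub>m \<chi>' \<and>
       (\<forall>e\<in>dom \<chi>' - dom \<chi>. e \<subseteq> insert w S \<and> (w \<in> e \<longrightarrow> \<chi>' e \<in> Some ` C)) \<and>
       costly \<kappa> (\<chi>' |` (dom \<chi>' - dom \<chi>)) w C (Suc d)"
      using gr' le new by blast
  qed
qed

section \<open>The alternating path\<close>

text \<open>The edge from \<open>u i\<close> to \<open>u (Suc i)\<close> has color \<open>alt i\<close>, and the other edges at \<open>u i\<close> have the colors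
  \<open>side \<Delta> c i\<close>.  The sets \<open>insert (alt i) (side \<Delta> c i)\<close> for \<open>i\<close> even and odd together cover the palette,
  so a path edge that cannot take a color of the former set takes one of the latter.\<close>

definition alt :: "nat \<Rightarrow> nat" where
  "alt i = (if even i then 2 else 1)"

definition side :: "nat \<Rightarrow> nat \<Rightarrow> nat \<Rightarrow> nat set" where
  "side \<Delta> c i = (if even i then {3..\<Delta>} else {c + 3..\<Delta> + c})"

definition path_edges :: "(nat \<Rightarrow> nat) \<Rightarrow> nat \<Rightarrow> edge set" where
  "path_edges u L = (\<lambda>i. {u i, u (Suc i)}) ` {..<L}"

text \<open>On the path only the colors 1 and 2 occur, and \<open>3 - a\<close> exchanges
  them.\<close>

definition flip :: "(nat \<Rightarrow> nat) \<Rightarrow> nat \<Rightarrow> coloring \<Rightarrow> coloring" where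
  "flip u L \<chi> = (\<lambda>f. if f \<in> path_edges u L then map_option (\<lambda>a. 3 - a) (\<chi> f) else \<chi> f)"

text \<open>The guards at the path need only budget \<open>L\<close>, since a guarded edge that
  leaves its set is itself a further change; at \<open>v\<close> the inserted edge does not count,
  hence \<open>Suc L\<close>. The disjointness conditions keep all trees off the path, so that a
  flip leaves them intact. Since 2 is missing at \<open>v\<close>, the flip makes room for the new
  edge.\<close>

definition bad :: "nat \<Rightarrow> nat \<Rightarrow> nat \<Rightarrow> nat \<Rightarrow> coloring \<Rightarrow> (nat \<Rightarrow> nat) \<Rightarrow> nat \<Rightarrow> bool" where
  "bad n \<Delta> c L \<chi> u v \<longleftrightarrow>
     valid_state n \<Delta> (\<Delta> + c) \<chi> \<and> inj_on u {..L} \<and> v \<notin> u ` {..L} \<and> v < n \<and>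
     (\<forall>i\<le>L. u i < n \<and> \<not> same_tree (dom \<chi>) (u i) v) \<and>
     (\<forall>i<L. \<chi> {u i, u (Suc i)} = Some (alt i)) \<and>
     (\<forall>i\<le>L. \<forall>f\<in>dom \<chi> - path_edges u L. u i \<in> f \<longrightarrow> \<chi> f \<in> Some ` side \<Delta> c i) \<and>
     2 \<notin> cols \<chi> v \<and> card (cols \<chi> v) < \<Delta> \<and>
     (\<forall>i\<le>L. \<forall>s\<in>side \<Delta> c i. \<exists>S. S \<inter> u ` {..L} = {} \<and>
        guarded (\<Delta> + c) \<chi> (u i) S (insert (alt i) (side \<Delta> c i)) s L) \<and>
     (\<exists>\<psi> C. \<psi> \<subseteq>\<^sub>m \<chi> \<and> dom \<psi> \<inter> path_edges u L = {} \<and>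
        {1..\<Delta> + c} - insert (alt 0) (side \<Delta> c 0) \<subseteq> C \<and> costly (\<Delta> + c) \<psi> v C (Suc L))"

lemma alt_notin_side: "alt i \<notin> side \<Delta> c j"
  unfolding alt_def side_def by auto

lemma alt_Suc: "3 - alt i = alt (Suc i)" "alt i \<noteq> alt (Suc i)"
  unfolding alt_def by auto

lemma card_side: "2 \<le> \<Delta> \<Longrightarrow> card (side \<Delta> c i) = \<Delta> - 2" "finite (side \<Delta> c i)"
  unfolding side_def by auto

lemma card_insert_side: "2 \<le> \<Delta> \<Longrightarrow> card (insert (alt j) (side \<Delta> c i)) = \<Delta> - 1"
  using card_side alt_notin_side by (simp add: Suc_diff_le numeral_2_eq_2)

text \<open>The union is \<open>{1..\<Delta>} \<union> {c + 3..\<Delta> + c}\<close>, which has no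
  gap exactly when \<open>c + 3 \<le> \<Delta> + 1\<close>.\<close>

lemma side_cover:
  "c + 2 \<le> \<Delta> \<Longrightarrow> {1..\<Delta> + c} \<subseteq> insert (alt i) (side \<Delta> c i) \<union> insert (alt (Suc i)) (side \<Delta> c (Suc i))"
  unfolding alt_def side_def by auto

lemma side_subset: "2 \<le> \<Delta> \<Longrightarrow> insert (alt j) (side \<Delta> c i) \<subseteq> {1..\<Delta> + c}"
  unfolding alt_def side_def by auto

section \<open>Path edges and the forced flip\<close>

lemma path_edge_inj:
  assumes "inj_on u {..L}" "i < L" "j < L" "{u i, u (Suc i)} = {u j, u (Suc j)}"
  shows "i = j"
proof -
  have "u i = u j \<or> u i = u (Suc j)" "u (Suc i) = u (Suc j) \<or> u (Suc i) = u j"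
    using assms(4) by (auto simp: doubleton_eq_iff)
  then have "i = j \<or> i = Suc j" "Suc i = Suc j \<or> Suc i = j"
    using assms(1-3) by (auto dest: inj_onD)
  then show ?thesis by linarith
qed

lemma card_path_edges: "inj_on u {..L} \<Longrightarrow> card (path_edges u L) = L"
  unfolding path_edges_def using path_edge_inj by (subst card_image) (auto intro!: inj_onI)

lemma path_edge_at:
  assumes "inj_on u {..L}" "f \<in> path_edges u L" "i \<le> L" "u i \<in> f"
  obtains "i < L" "f = {u i, u (Suc i)}" | j where "i = Suc j" "f = {u j, u i}"
proof -
  obtain j where j: "j < L" "f = {u j, u (Suc j)}" using assms(2) unfolding path_edges_def by blast
  then have "i = j \<or> i = Suc j"
    using assms(1,3,4) by (auto dest: inj_onD)
  then show ?thesis using that j by auto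
qed

lemma path_edge_colors:
  assumes "\<And>i. i < L \<Longrightarrow> \<chi> {u i, u (Suc i)} = Some (alt i)" "f \<in> path_edges u L"
  shows "\<chi> f \<in> Some ` {1, 2}"
  using assms unfolding path_edges_def alt_def by force

lemma dom_flip: "dom (flip u L \<chi>) = dom \<chi>"
  unfolding flip_def by (auto split: if_splits)

text \<open>Edges at a common vertex have different colors, so \<open>card C\<close> of them with
  colors in \<open>C\<close> use up \<open>C\<close>. This is the mechanism by which a change is
  passed along the path.\<close>

lemma color_set_exhausted:
  assumes p: "proper_coloring \<kappa> \<chi>" and F: "\<And>f. f \<in> F \<Longrightarrow> w \<in> f \<and> \<chi> f \<in> Some ` C"
    and C: "finite C" "card C \<le> card F" and q: "w \<in> q" "q \<notin> F"
  shows "\<chi> q \<notin> Some ` C"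
proof
  assume "\<chi> q \<in> Some ` C"
  then obtain a where a: "\<chi> q = Some a" "a \<in> C" by blast
  let ?g = "\<lambda>f. the (\<chi> f)"
  have g: "\<chi> f = Some (?g f)" "?g f \<in> C" if "f \<in> F" for f using F[OF that] by auto
  have inj: "inj_on ?g F"
  proof (rule inj_onI)
    fix f f' assume f: "f \<in> F" "f' \<in> F" "?g f = ?g f'"
    then show "f = f'"
      using proper_same[OF p g(1)[OF f(1)], of f' w] g(1)[OF f(2)] F by simp
  qed
  have sub: "?g ` F \<subseteq> C - {a}"
  proof
    fix x assume "x \<in> ?g ` F"
    then obtain f where f: "f \<in> F" "x = ?g f" by blast
    have "x \<noteq> a"
      using proper_same[OF p g(1)[OF f(1)], of q w] a(1) f q F[OF f(1)] by auto
    then show "x \<in> C - {a}" using g(2)[OF f(1)] f(2) by blast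
  qed
  have "card F \<le> card (C - {a})"
    using card_inj_on_le[OF inj sub] C(1) by simp
  then show False using a(2) C card_Diff1_less[of C a] by linarith
qed

text \<open>Flipping is admissible, so at most \<open>L\<close> edges change, and within this budget
  all guards hold. The new edge must take a color of \<open>?C 0\<close>, which pushes
  \<open>?q 0\<close> out of \<open>?C 0\<close> and hence into \<open>?C 1\<close>; this pushes
  \<open>?q 1\<close> out of \<open>?C 1\<close>, and so on. All \<open>L\<close> path edges change,
  so no other edge may, and this determines every color.\<close>

lemma bad_insert:
  assumes B: "bad n \<Delta> c L \<chi> u v" and c: "c + 2 \<le> \<Delta>" and L: "0 < L"
    and out: "greedy_outcome (\<Delta> + c) \<chi> {u 0, v} \<chi>'"
  shows "\<chi>' = (flip u L \<chi>)({u 0, v} \<mapsto> 2)"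
proof -
  let ?\<kappa> = "\<Delta> + c" and ?Q = "path_edges u L" and ?e = "{u 0, v}"
  let ?C = "\<lambda>i. insert (alt i) (side \<Delta> c i)"
  let ?q = "\<lambda>i. {u i, u (Suc i)}"
  have val: "valid_state n \<Delta> ?\<kappa> \<chi>" and inj: "inj_on u {..L}" and vu: "v \<notin> u ` {..L}"
    and ns: "\<not> same_tree (dom \<chi>) (u 0) v"
    and q: "\<And>i. i < L \<Longrightarrow> \<chi> (?q i) = Some (alt i)"
    and sd: "\<And>i f. i \<le> L \<Longrightarrow> f \<in> dom \<chi> \<Longrightarrow> f \<notin> ?Q \<Longrightarrow> u i \<in> f \<Longrightarrow> \<chi> f \<in> Some ` side \<Delta> c i"
    and v2: "2 \<notin> cols \<chi> v"
    and G: "\<And>i s. i \<le> L \<Longrightarrow> s \<in> side \<Delta> c i \<Longrightarrow> \<exists>S. S \<inter> u ` {..L} = {} \<and> guarded ?\<kappa> \<chi> (u i) S (?C i) s L"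
    and H: "\<exists>\<psi> C. \<psi> \<subseteq>\<^sub>m \<chi> \<and> dom \<psi> \<inter> ?Q = {} \<and> {1..?\<kappa>} - ?C 0 \<subseteq> C \<and> costly ?\<kappa> \<psi> v C (Suc L)"
    using B unfolding bad_def by auto
  have p: "proper_coloring ?\<kappa> \<chi>" using val unfolding valid_state_def by simp
  have fin: "finite (dom \<chi>)" using valid_finite[OF val] .
  have new: "?e \<notin> dom \<chi>" using not_same_tree_edge[OF ns] .
  have Qd: "?Q \<subseteq> dom \<chi>" using q unfolding path_edges_def by auto
  have D2: "2 \<le> \<Delta>" using c by simp
  have flipQ: "flip u L \<chi> (?q i) = Some (alt (Suc i))" if "i < L" for i
    using that q alt_Suc(1) unfolding flip_def path_edges_def by simp
  have flipN: "flip u L \<chi> f = \<chi> f" if "f \<notin> ?Q" for f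
    using that unfolding flip_def by simp
  have low: "\<chi> f \<in> Some ` {1, 2}" "flip u L \<chi> f \<in> Some ` {1, 2}" if "f \<in> ?Q" for f
    using that q flipQ unfolding path_edges_def alt_def by force+
  have high: "a \<notin> {1, 2}" if "a \<in> side \<Delta> c i" for a i
    using that unfolding side_def by (auto split: if_splits)
  have QN: "flip u L \<chi> f \<noteq> flip u L \<chi> g"
    if f: "f \<in> ?Q" and g: "g \<in> dom \<chi>" "g \<notin> ?Q" and fg: "f \<inter> g \<noteq> {}" for f g
  proof -
    obtain i where "i \<le> L" "u i \<in> g"
      using f fg unfolding path_edges_def by fastforce
    then obtain a where "\<chi> g = Some a" "a \<in> side \<Delta> c i" using sd g by blast
    then show ?thesis using low(2)[OF f] flipN[OF g(2)] high[of a i] by auto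
  qed
  have pf: "proper_coloring ?\<kappa> (flip u L \<chi>)"
    unfolding proper_coloring_def
  proof (intro conjI ballI impI)
    show "ran (flip u L \<chi>) \<subseteq> {1..?\<kappa>}"
    proof
      fix a assume "a \<in> ran (flip u L \<chi>)"
      then obtain f where f: "flip u L \<chi> f = Some a" unfolding ran_def by blast
      show "a \<in> {1..?\<kappa>}"
      proof (cases "f \<in> ?Q")
        case True
        then show ?thesis using low(2)[OF True] f D2 by auto
      next
        case False
        then show ?thesis using flipN f p unfolding proper_coloring_def by (metis ranI subsetD)
      qed
    qed
  next
    fix f g assume fg: "f \<in> dom (flip u L \<chi>)" "g \<in> dom (flip u L \<chi>)" "f \<noteq> g \<and> f \<inter> g \<noteq> {}"
    then have d: "f \<in> dom \<chi>" "g \<in> dom \<chi>" unfolding dom_flip by auto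
    then have ne: "\<chi> f \<noteq> \<chi> g" using fg(3) p unfolding proper_coloring_def by blast
    consider "f \<in> ?Q" "g \<in> ?Q" | "f \<in> ?Q" "g \<notin> ?Q" | "f \<notin> ?Q" "g \<in> ?Q" | "f \<notin> ?Q" "g \<notin> ?Q" by blast
    then show "flip u L \<chi> f \<noteq> flip u L \<chi> g"
    proof cases
      case 1
      then show ?thesis using low(1) ne unfolding flip_def by force
    next
      case 2
      then show ?thesis using QN d fg(3) by blast
    next
      case 3
      then show ?thesis using QN[of g f] d fg(3) by (metis inf_commute)
    next
      case 4
      then show ?thesis using flipN ne by metis
    qed
  qed
  have u0: "2 \<notin> cols (flip u L \<chi>) (u 0)"
  proof
    assume "2 \<in> cols (flip u L \<chi>) (u 0)"
    then obtain f where f: "flip u L \<chi> f = Some 2" "u 0 \<in> f" unfolding cols_def by blast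
    show False
    proof (cases "f \<in> ?Q")
      case True
      have "f = ?q 0"
        using path_edge_at[OF inj True le0 f(2)] by (metis nat.distinct(1))
      then show False using f(1) flipQ[OF L] by (simp add: alt_def)
    next
      case False
      then have "\<chi> f = Some 2" using f(1) flipN by simp
      then have "2 \<in> side \<Delta> c 0" using sd[OF le0 _ False f(2)] by auto
      then show False using high by blast
    qed
  qed
  have v2': "2 \<notin> cols (flip u L \<chi>) v"
  proof
    assume "2 \<in> cols (flip u L \<chi>) v"
    then obtain f where f: "flip u L \<chi> f = Some 2" "v \<in> f" unfolding cols_def by blast
    have "f \<notin> ?Q"
      using f(2) vu unfolding path_edges_def by auto
    then have "\<chi> f = Some 2" using f(1) flipN by simp
    then show False using v2 f(2) unfolding cols_def by blast
  qed
  have "can_recolor ?\<kappa> \<chi> ?e ?Q"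
    unfolding can_recolor_def recolors_to_def
  proof (intro conjI exI)
    show "?Q \<subseteq> dom \<chi>" using Qd .
    show "dom ((flip u L \<chi>)(?e \<mapsto> 2)) = insert ?e (dom \<chi>)" by (simp add: dom_flip)
    show "proper_coloring ?\<kappa> ((flip u L \<chi>)(?e \<mapsto> 2))"
      using proper_coloring_insert[OF pf _ u0 v2'] new D2 by (simp add: dom_flip)
    show "\<forall>f\<in>dom \<chi> - ?Q. ((flip u L \<chi>)(?e \<mapsto> 2)) f = \<chi> f"
      using flipN new by auto
  qed
  moreover obtain H where arg: "is_arg_min card (can_recolor ?\<kappa> \<chi> ?e) H"
    and rec: "recolors_to ?\<kappa> \<chi> ?e H \<chi>'"
    using out unfolding greedy_outcome_def by blast
  ultimately have "card H \<le> card ?Q"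
    unfolding is_arg_min_def by (meson not_le)
  then have cH: "card H \<le> L" using card_path_edges[OF inj] by simp
  have Hd: "H \<subseteq> dom \<chi>" using arg unfolding is_arg_min_def can_recolor_def by blast
  have d': "dom \<chi>' = insert ?e (dom \<chi>)" and p': "proper_coloring ?\<kappa> \<chi>'"
    and keep: "\<And>f. f \<in> dom \<chi> \<Longrightarrow> f \<notin> H \<Longrightarrow> \<chi>' f = \<chi> f"
    using rec unfolding recolors_to_def by auto
  let ?R = "{f \<in> dom \<chi>. \<chi>' f \<noteq> \<chi> f}"
  have RH: "?R \<subseteq> H" using keep by blast
  have cR: "card ?R \<le> L" using card_mono[OF finite_subset[OF Hd fin] RH] cH by simp
  have dsub: "dom \<chi> \<subseteq> dom \<chi>'" using d' by blast
  have inC: "\<chi>' f \<in> Some ` {1..?\<kappa>}" if "f \<in> dom \<chi>'" for f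
    using that p' unfolding proper_coloring_def by (auto intro: ranI)
  \<comment> \<open>Any other color of the new edge would cost \<open>Suc L\<close> changes in the
    tree at \<open>v\<close>.\<close>
  have e0: "\<chi>' ?e \<in> Some ` ?C 0"
  proof (rule ccontr)
    assume na: "\<chi>' ?e \<notin> Some ` ?C 0"
    obtain \<psi> C where psi: "\<psi> \<subseteq>\<^sub>m \<chi>" "{1..?\<kappa>} - ?C 0 \<subseteq> C" "costly ?\<kappa> \<psi> v C (Suc L)"
      using H by blast
    have dd: "dom \<psi> \<subseteq> dom \<chi>" using psi(1) by (rule map_le_implies_dom_le)
    have "\<chi>' ?e \<in> Some ` C" using inC[of ?e] na psi(2) d' by blast
    then have "Suc L \<le> card {f \<in> dom \<psi>. \<chi>' f \<noteq> \<psi> f}"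
      using psi(3) p' dd dsub d' new unfolding costly_def by blast
    also have "\<dots> \<le> card ?R"
      using fin dd psi(1) unfolding map_le_def by (intro card_mono) (auto dest!: bspec)
    finally show False using cR by simp
  qed
  have "\<exists>E. \<forall>s\<in>side \<Delta> c i. \<chi> (E s) = Some s \<and> u i \<in> E s \<and> \<chi>' (E s) \<in> Some ` ?C i" if i: "i \<le> L" for i
  proof -
    have "\<exists>f. \<chi> f = Some s \<and> u i \<in> f \<and> \<chi>' f \<in> Some ` ?C i" if s: "s \<in> side \<Delta> c i" for s
    proof -
      obtain S where S: "S \<inter> u ` {..L} = {}" "guarded ?\<kappa> \<chi> (u i) S (?C i) s L" using G[OF i s] by blast
      have "u i \<notin> S" using S(1) i by auto
      then show ?thesis
        using guarded_cost[OF S(2) _ _ fin p' dsub cR] s by (metis insertI1 insertI2)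
    qed
    then have "\<forall>s\<in>side \<Delta> c i. \<exists>f. \<chi> f = Some s \<and> u i \<in> f \<and> \<chi>' f \<in> Some ` ?C i" by blast
    then show ?thesis by (rule bchoice)
  qed
  then have "\<forall>i\<in>{..L}. \<exists>E. \<forall>s\<in>side \<Delta> c i. \<chi> (E s) = Some s \<and> u i \<in> E s \<and> \<chi>' (E s) \<in> Some ` ?C i"
    by blast
  \<comment> \<open>\<open>E i s\<close> is the side edge at \<open>u i\<close> with old color
    \<open>s\<close>. At this point its new color is only known to lie in \<open>?C i\<close>: side
    colors might still be permuted.\<close>
  then obtain E where "\<forall>i\<in>{..L}. \<forall>s\<in>side \<Delta> c i. \<chi> (E i s) = Some s \<and> u i \<in> E i s \<and> \<chi>' (E i s) \<in> Some ` ?C i"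
    by (rule bchoice[THEN exE])
  then have E: "\<chi> (E i s) = Some s" "u i \<in> E i s" "\<chi>' (E i s) \<in> Some ` ?C i"
    if "i \<le> L" "s \<in> side \<Delta> c i" for i s using that by auto
  \<comment> \<open>The \<open>\<Delta> - 2\<close> side edges at \<open>u i\<close> together with
    \<open>g\<close> occupy all \<open>\<Delta> - 1\<close> colors of \<open>?C i\<close>.\<close>
  have exh: "\<chi>' f \<notin> Some ` ?C i"
    if i: "i \<le> L" and g: "g \<notin> E i ` side \<Delta> c i" "u i \<in> g" "\<chi>' g \<in> Some ` ?C i"
      and f: "f \<notin> insert g (E i ` side \<Delta> c i)" "u i \<in> f" for i f g
  proof (rule color_set_exhausted[OF p' _ _ _ f(2,1)])
    show "u i \<in> h \<and> \<chi>' h \<in> Some ` ?C i" if "h \<in> insert g (E i ` side \<Delta> c i)" for h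
      using that g E(2,3)[OF i] by blast
    show "finite (?C i)" using card_side(2) by simp
    have "inj_on (E i) (side \<Delta> c i)"
      using E(1)[OF i] by (intro inj_onI) (metis option.inject)
    then have "card (insert g (E i ` side \<Delta> c i)) = \<Delta> - 1"
      using g(1) card_side(1)[OF D2] D2 by (simp add: card_image card_side(2))
    then show "card (?C i) \<le> card (insert g (E i ` side \<Delta> c i))"
      using card_insert_side[OF D2] by simp
  qed
  have qE: "?q i \<notin> E j ` side \<Delta> c j" if "i < L" "j \<le> L" for i j
    using E(1)[OF that(2)] q[OF that(1)] alt_notin_side by (metis image_iff option.inject)
  have eE: "?e \<notin> E j ` side \<Delta> c j" if "j \<le> L" for j
    using E(1)[OF that] new by (metis domI image_iff)
  have qd: "?q i \<in> dom \<chi>" if "i < L" for i using q[OF that] by blast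
  \<comment> \<open>The old color \<open>alt i\<close> of \<open>?q i\<close> lies in
    \<open>?C i\<close>, so being outside \<open>?C i\<close> means that the edge has changed. The
    second half is what pushes the next edge out of its set.\<close>
  have qC: "\<chi>' (?q i) \<notin> Some ` ?C i \<and> \<chi>' (?q i) \<in> Some ` ?C (Suc i)" if "i < L" for i
    using that
  proof (induction i)
    case 0
    have "?q 0 \<notin> insert ?e (E 0 ` side \<Delta> c 0)"
      using qE[OF L le0] new qd[OF L] by (metis insertE)
    then have "\<chi>' (?q 0) \<notin> Some ` ?C 0"
      by (rule exh[OF le0 eE[OF le0] insertI1 e0 _ insertI1])
    then show ?case
      using inC[of "?q 0"] qd[OF L] dsub side_cover[OF c, of 0] by blast
  next
    case (Suc i)
    then have IH: "\<chi>' (?q i) \<in> Some ` ?C (Suc i)" and iL: "i < L" "Suc i \<le> L" by auto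
    have "?q (Suc i) \<noteq> ?q i" using path_edge_inj[OF inj Suc.prems iL(1)] by auto
    then have "?q (Suc i) \<notin> insert (?q i) (E (Suc i) ` side \<Delta> c (Suc i))"
      using qE[OF Suc.prems iL(2)] by (metis insertE)
    then have "\<chi>' (?q (Suc i)) \<notin> Some ` ?C (Suc i)"
      by (rule exh[OF iL(2) qE[OF iL] insertI2[OF insertI1] IH _ insertI1])
    then show ?case
      using inC[of "?q (Suc i)"] qd[OF Suc.prems] dsub side_cover[OF c, of "Suc i"] by blast
  qed
  have "?Q \<subseteq> ?R"
    using qC q qd unfolding path_edges_def by fastforce
  \<comment> \<open>The path alone exhausts the budget of \<open>L\<close> changes.\<close>
  then have RQ: "?R = ?Q"
    using cR card_path_edges[OF inj] fin by (metis (no_types, lifting) card_seteq finite_Collect_conjI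
        finite_subset mem_Collect_eq subsetI)
  have same: "\<chi>' f = \<chi> f" if "f \<in> dom \<chi>" "f \<notin> ?Q" for f
    using RQ that by blast
  have EE: "\<chi>' (E i s) = Some s" if "i \<le> L" "s \<in> side \<Delta> c i" for i s
  proof -
    have "E i s \<notin> ?Q"
      using low(1) high[OF that(2)] E(1)[OF that] by force
    then show ?thesis using same E(1)[OF that] by (metis domI)
  qed
  \<comment> \<open>The side edges are now known to keep their colors, so \<open>alt i\<close> is
    the only color of \<open>?C i\<close> left for another edge at \<open>u i\<close>.\<close>
  have take: "\<chi>' f = Some (alt i)"
    if i: "i \<le> L" and f: "u i \<in> f" "f \<notin> E i ` side \<Delta> c i" "\<chi>' f \<in> Some ` ?C i" for i f
  proof -
    obtain a where a: "\<chi>' f = Some a" "a \<in> ?C i" using f(3) by blast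
    have "a \<notin> side \<Delta> c i"
    proof
      assume "a \<in> side \<Delta> c i"
      then have "f = E i a"
        using proper_same[OF p' a(1) EE f(1) E(2)] i by blast
      then show False using f(2) \<open>a \<in> side \<Delta> c i\<close> by blast
    qed
    then show ?thesis using a by blast
  qed
  show ?thesis
  proof
    fix f
    consider "f = ?e" | i where "i < L" "f = ?q i" | "f \<in> dom \<chi>" "f \<notin> ?Q" "f \<noteq> ?e" | "f \<notin> dom \<chi>'"
      using d' unfolding path_edges_def by blast
    then show "\<chi>' f = ((flip u L \<chi>)(?e \<mapsto> 2)) f"
    proof cases
      case 1
      then show ?thesis using take[OF le0 _ eE e0] by (simp add: alt_def)
    next
      case 2
      have "?q i \<noteq> ?e" using qd[OF 2(1)] new by metis
      then show ?thesis
        using take[of "Suc i" "?q i"] 2 qE qC flipQ by auto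
    next
      case 3
      then show ?thesis using same flipN by simp
    next
      case 4
      then have "f \<notin> dom (flip u L \<chi>)" "f \<noteq> ?e" using d' dom_flip by auto
      then show ?thesis using 4 by (auto simp: domIff)
    qed
  qed
qed

section \<open>Forcing the path back and forth\<close>

text \<open>For even \<open>L\<close> the positions \<open>i\<close> and \<open>L - i\<close> have
  equal parity. Thus both ends of the path are of the same type, and the same vertex
  \<open>v\<close> with the same missing color 2 serves for both.\<close>

lemma bad_rev:
  assumes L: "even L" "i \<le> L"
  shows "alt (L - i) = alt i" "side \<Delta> c (L - i) = side \<Delta> c i"
  using assms unfolding alt_def side_def by auto

lemma path_edges_rev: "path_edges (\<lambda>i. u (L - i)) L = path_edges u L"
proof -
  have "path_edges (\<lambda>i. u (L - i)) L \<subseteq> path_edges u L" for u :: "nat \<Rightarrow> nat"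
  proof
    fix f assume "f \<in> path_edges (\<lambda>i. u (L - i)) L"
    then obtain i where i: "i < L" "f = {u (L - i), u (L - Suc i)}"
      unfolding path_edges_def by blast
    then have "f = {u (L - Suc i), u (Suc (L - Suc i))}"
      by (simp add: Suc_diff_Suc insert_commute)
    then show "f \<in> path_edges u L"
      unfolding path_edges_def using i(1) by (intro image_eqI[of _ _ "L - Suc i"]) auto
  qed
  from this[of u] this[of "\<lambda>i. u (L - i)"] show ?thesis
    unfolding path_edges_def by (auto simp: image_iff)
qed

lemma valid_flip:
  assumes B: "bad n \<Delta> c L \<chi> u v" and p: "proper_coloring (\<Delta> + c) (flip u L \<chi>)"
  shows "valid_state n \<Delta> (\<Delta> + c) (flip u L \<chi>)"
  using assms unfolding bad_def valid_state_def by (simp add: dom_flip)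

text \<open>Exchanging the two colors and reading the path backwards both shift the alternation by
  one, so together they restore it. All other conditions concern edges off the path, which the flip
  does not touch.\<close>

lemma bad_flip:
  assumes B: "bad n \<Delta> c L \<chi> u v" and L: "even L"
    and p: "proper_coloring (\<Delta> + c) (flip u L \<chi>)"
  shows "bad n \<Delta> c L (flip u L \<chi>) (\<lambda>i. u (L - i)) v"
proof -
  let ?Q = "path_edges u L" and ?r = "\<lambda>i. u (L - i)"
  have inj: "inj_on u {..L}" using B unfolding bad_def by simp
  have vu: "v \<notin> u ` {..L}" using B unfolding bad_def by simp
  have q: "\<chi> {u i, u (Suc i)} = Some (alt i)" if "i < L" for i
    using B that unfolding bad_def by simp
  have N: "flip u L \<chi> f = \<chi> f" if "f \<notin> ?Q" for f
    using that unfolding flip_def by simp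
  have img: "?r ` {..L} = u ` {..L}"
    by (auto simp: image_iff) (metis atMost_iff diff_diff_cancel diff_le_self)
  have "inj_on ?r {..L}"
    using inj by (intro inj_onI) (metis atMost_iff diff_diff_cancel diff_le_self inj_onD)
  moreover have "flip u L \<chi> {?r i, ?r (Suc i)} = Some (alt i)" if i: "i < L" for i
  proof -
    let ?j = "L - Suc i"
    have j: "?j < L" "{?r i, ?r (Suc i)} = {u ?j, u (Suc ?j)}"
      using i by (auto simp: Suc_diff_Suc)
    then have "{u ?j, u (Suc ?j)} \<in> ?Q" unfolding path_edges_def by blast
    then have "flip u L \<chi> {u ?j, u (Suc ?j)} = Some (alt (Suc ?j))"
      using q[OF j(1)] alt_Suc(1) unfolding flip_def by simp
    moreover have "alt (Suc ?j) = alt i"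
      using bad_rev(1)[OF L, of i] i by (simp add: Suc_diff_Suc)
    ultimately show ?thesis using j(2) by simp
  qed
  moreover have "\<forall>f\<in>dom (flip u L \<chi>) - path_edges ?r L. ?r i \<in> f \<longrightarrow> flip u L \<chi> f \<in> Some ` side \<Delta> c i"
    if i: "i \<le> L" for i
  proof -
    have "\<forall>f\<in>dom \<chi> - ?Q. u (L - i) \<in> f \<longrightarrow> \<chi> f \<in> Some ` side \<Delta> c (L - i)"
      using B unfolding bad_def by simp
    then show ?thesis
      unfolding path_edges_rev dom_flip bad_rev(2)[OF L i] using N by simp
  qed
  moreover have cv: "cols (flip u L \<chi>) v = cols \<chi> v"
  proof -
    have "f \<notin> ?Q" if "v \<in> f" for f using that vu unfolding path_edges_def by auto
    then show ?thesis unfolding cols_def using N by (metis (no_types, lifting))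
  qed
  moreover have "\<exists>S. S \<inter> ?r ` {..L} = {} \<and>
      guarded (\<Delta> + c) (flip u L \<chi>) (?r i) S (insert (alt i) (side \<Delta> c i)) s L"
    if i: "i \<le> L" and s: "s \<in> side \<Delta> c i" for i s
  proof -
    have "\<forall>s\<in>side \<Delta> c (L - i). \<exists>S. S \<inter> u ` {..L} = {} \<and>
        guarded (\<Delta> + c) \<chi> (u (L - i)) S (insert (alt (L - i)) (side \<Delta> c (L - i))) s L"
      using B unfolding bad_def by (meson diff_le_self)
    then obtain S where S: "S \<inter> u ` {..L} = {}"
      "guarded (\<Delta> + c) \<chi> (u (L - i)) S (insert (alt i) (side \<Delta> c i)) s L"
      using s unfolding bad_rev[OF L i] by blast
    obtain y \<psi> C' where y: "y \<in> S" "\<chi> {?r i, y} = Some s" "\<psi> \<subseteq>\<^sub>m \<chi>" "dom \<psi> \<subseteq> Pow S"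
      "{1..\<Delta> + c} - insert (alt i) (side \<Delta> c i) \<subseteq> C'" "costly (\<Delta> + c) \<psi> y C' L"
      using S(2) unfolding guarded_def by blast
    have Q: "\<exists>j\<le>L. \<exists>k\<le>L. f = {u j, u k}" if "f \<in> ?Q" for f
      using that unfolding path_edges_def by (auto intro: less_imp_le Suc_leI)
    have "{?r i, y} \<notin> ?Q"
    proof
      assume "{?r i, y} \<in> ?Q"
      then obtain j k where "j \<le> L" "k \<le> L" "{?r i, y} = {u j, u k}" using Q by blast
      then have "y \<in> u ` {..L}" by (auto simp: doubleton_eq_iff)
      then show False using y(1) S(1) by blast
    qed
    moreover have "f \<notin> ?Q" if "f \<in> dom \<psi>" for f
    proof
      assume "f \<in> ?Q"
      then obtain j k where "j \<le> L" "k \<le> L" "f = {u j, u k}" using Q by blast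
      then show False using that y(4) S(1) by blast
    qed
    then have "\<psi> \<subseteq>\<^sub>m flip u L \<chi>"
      using y(3) N unfolding map_le_def by simp
    moreover have "flip u L \<chi> {?r i, y} = Some s"
      using N[OF \<open>{?r i, y} \<notin> ?Q\<close>] y(2) by simp
    ultimately have "guarded (\<Delta> + c) (flip u L \<chi>) (?r i) S (insert (alt i) (side \<Delta> c i)) s L"
      using y unfolding guarded_def by blast
    then show ?thesis unfolding img using S(1) by blast
  qed
  moreover have "\<exists>\<psi> C. \<psi> \<subseteq>\<^sub>m flip u L \<chi> \<and> dom \<psi> \<inter> path_edges ?r L = {} \<and>
      {1..\<Delta> + c} - insert (alt 0) (side \<Delta> c 0) \<subseteq> C \<and> costly (\<Delta> + c) \<psi> v C (Suc L)"
  proof -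
    have "\<exists>\<psi> C. \<psi> \<subseteq>\<^sub>m \<chi> \<and> dom \<psi> \<inter> ?Q = {} \<and>
        {1..\<Delta> + c} - insert (alt 0) (side \<Delta> c 0) \<subseteq> C \<and> costly (\<Delta> + c) \<psi> v C (Suc L)"
      using B unfolding bad_def by (elim conjE)
    then obtain \<psi> C where psi: "\<psi> \<subseteq>\<^sub>m \<chi>" "dom \<psi> \<inter> ?Q = {}"
      "{1..\<Delta> + c} - insert (alt 0) (side \<Delta> c 0) \<subseteq> C" "costly (\<Delta> + c) \<psi> v C (Suc L)"
      by (elim exE conjE)
    have "\<psi> \<subseteq>\<^sub>m flip u L \<chi>"
      unfolding map_le_def
    proof
      fix f assume f: "f \<in> dom \<psi>"
      then have "f \<notin> ?Q" using psi(2) by blast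
      then show "\<psi> f = flip u L \<chi> f" using N psi(1) f unfolding map_le_def by simp
    qed
    then show ?thesis using psi unfolding path_edges_rev by blast
  qed
  moreover have "\<forall>i\<le>L. ?r i < n \<and> \<not> same_tree (dom (flip u L \<chi>)) (?r i) v"
    using B unfolding bad_def dom_flip by simp
  moreover have "v < n" "2 \<notin> cols \<chi> v" "card (cols \<chi> v) < \<Delta>" using B unfolding bad_def by auto
  moreover have "v \<notin> ?r ` {..L}" using vu img by simp
  ultimately show ?thesis
    unfolding bad_def cv using valid_flip[OF B p] by (intro conjI) (assumption | intro allI impI ballI | meson)+
qed

section \<open>The infinite update sequence\<close>

lemma bad_step:
  assumes B: "bad n \<Delta> c L \<chi> u v" and c: "c + 2 \<le> \<Delta>" and L: "0 < L" "even L"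
    and g: "greedy_rule n \<Delta> (\<Delta> + c) A"
  defines "e \<equiv> {u 0, v}"
  shows "legal n \<Delta> (dom \<chi>) (Ins e)" "legal n \<Delta> (dom (A \<chi> e)) (Del e)" "L \<le> recourse \<chi> (A \<chi> e)"
    "bad n \<Delta> c L ((A \<chi> e)(e := None)) (\<lambda>i. u (L - i)) v"
proof -
  let ?Q = "path_edges u L"
  have val: "valid_state n \<Delta> (\<Delta> + c) \<chi>" and inj: "inj_on u {..L}"
    and uv: "u 0 < n" "v < n" "\<not> same_tree (dom \<chi>) (u 0) v"
    and q: "\<And>i. i < L \<Longrightarrow> \<chi> {u i, u (Suc i)} = Some (alt i)"
    and sd: "\<And>f. f \<in> dom \<chi> \<Longrightarrow> f \<notin> ?Q \<Longrightarrow> u 0 \<in> f \<Longrightarrow> \<chi> f \<in> Some ` side \<Delta> c 0"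
    and cv: "card (cols \<chi> v) < \<Delta>"
    using B unfolding bad_def by auto
  have "cols \<chi> (u 0) \<subseteq> insert (alt 0) (side \<Delta> c 0)"
  proof
    fix a assume "a \<in> cols \<chi> (u 0)"
    then obtain f where f: "\<chi> f = Some a" "u 0 \<in> f" unfolding cols_def by blast
    show "a \<in> insert (alt 0) (side \<Delta> c 0)"
    proof (cases "f \<in> ?Q")
      case True
      have "f = {u 0, u (Suc 0)}"
        using path_edge_at[OF inj True le0 f(2)] by (metis nat.distinct(1))
      then show ?thesis using q[OF L(1)] f(1) by simp
    next
      case False
      then show ?thesis using sd[of f] f by auto
    qed
  qed
  then have "card (cols \<chi> (u 0)) \<le> \<Delta> - 1"
    using card_mono[of "insert (alt 0) (side \<Delta> c 0)"] card_insert_side[of \<Delta> 0 c 0] c card_side(2)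
    by fastforce
  then have cu: "card (cols \<chi> (u 0)) < \<Delta>" using c by simp
  show leg: "legal n \<Delta> (dom \<chi>) (Ins e)"
    unfolding e_def by (rule legal_insert[OF val uv cu cv])
  then have "greedy_outcome (\<Delta> + c) \<chi> e (A \<chi> e)"
    using g val unfolding greedy_rule_def by blast
  then have A: "A \<chi> e = (flip u L \<chi>)(e \<mapsto> 2)" and p': "proper_coloring (\<Delta> + c) (A \<chi> e)"
    using bad_insert[OF B c L(1)] unfolding e_def greedy_outcome_def recolors_to_def by blast+
  show "legal n \<Delta> (dom (A \<chi> e)) (Del e)" using A by simp
  have new: "e \<notin> dom \<chi>" unfolding e_def using not_same_tree_edge[OF uv(3)] .
  then have "e \<notin> dom (flip u L \<chi>)" unfolding dom_flip .
  then have Ad: "(A \<chi> e)(e := None) = flip u L \<chi>" using A by (auto simp: domIff)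
  have "flip u L \<chi> \<subseteq>\<^sub>m A \<chi> e"
    unfolding A by (rule map_le_upd_new) (use \<open>e \<notin> dom (flip u L \<chi>)\<close> in simp)
  moreover have "finite (dom \<chi>)" using valid_finite[OF val] .
  ultimately have p: "proper_coloring (\<Delta> + c) (flip u L \<chi>)"
    using proper_coloring_sub[OF p'] by blast
  show "bad n \<Delta> c L ((A \<chi> e)(e := None)) (\<lambda>i. u (L - i)) v"
    unfolding Ad using bad_flip[OF B L(2) p] .
  have "?Q \<subseteq> {f \<in> dom \<chi> \<inter> dom (A \<chi> e). A \<chi> e f \<noteq> \<chi> f}"
  proof
    fix f assume f: "f \<in> ?Q"
    then obtain i where i: "\<chi> f = Some (alt i)" using q unfolding path_edges_def by blast
    then have "flip u L \<chi> f = Some (alt (Suc i))" using f alt_Suc(1) unfolding flip_def by simp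
    moreover have "f \<noteq> e" using new i by auto
    ultimately show "f \<in> {f \<in> dom \<chi> \<inter> dom (A \<chi> e). A \<chi> e f \<noteq> \<chi> f}"
      using i A alt_Suc(2)[of i] by auto
  qed
  moreover have "finite {f \<in> dom \<chi> \<inter> dom (A \<chi> e). A \<chi> e f \<noteq> \<chi> f}"
    by (rule finite_subset[OF _ \<open>finite (dom \<chi>)\<close>]) blast
  ultimately have "card ?Q \<le> recourse \<chi> (A \<chi> e)"
    unfolding recourse_def by (intro card_mono)
  then show "L \<le> recourse \<chi> (A \<chi> e)"
    using card_path_edges[OF inj] by simp
qed

text \<open>The vertex at position 0 alternates between \<open>u 0\<close> and \<open>u L\<close>.
  Reversing twice gives back \<open>u\<close> only on \<open>{..L}\<close>, because of the truncated
  subtraction, so the iterate is kept instead of a case distinction on the parity of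
  \<open>k\<close>.\<close>

fun reversals :: "nat \<Rightarrow> nat \<Rightarrow> (nat \<Rightarrow> nat) \<Rightarrow> nat \<Rightarrow> nat" where
  "reversals L 0 u = u"
| "reversals L (Suc k) u = (\<lambda>i. reversals L k u (L - i))"

lemma bad_sequence:
  assumes B: "bad n \<Delta> c L \<chi> u v" and c: "c + 2 \<le> \<Delta>" and L: "0 < L" "even L"
    and g: "greedy_rule n \<Delta> (\<Delta> + c) A"
  shows "\<exists>\<sigma>. legal_sequence n \<Delta> A \<chi> \<sigma> \<and> (\<forall>T. L * (T div 2) \<le> total_recourse A \<chi> \<sigma> T)"
proof -
  define e where "e k = {reversals L k u 0, v}" for k
  define \<sigma> where "\<sigma> t = (if even t then Ins (e (t div 2)) else Del (e (t div 2)))" for t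
  let ?run = "run A \<chi> \<sigma>"
  have s: "\<sigma> (2 * k) = Ins (e k)" "\<sigma> (Suc (2 * k)) = Del (e k)" for k
    unfolding \<sigma>_def by auto
  have odd: "?run (Suc (2 * k)) = A (?run (2 * k)) (e k)"
    "?run (2 * Suc k) = (A (?run (2 * k)) (e k))(e k := None)" for k
    using s[of k] by auto
  have bad: "bad n \<Delta> c L (?run (2 * k)) (reversals L k u) v" for k
  proof (induction k)
    case 0
    then show ?case using B by simp
  next
    case (Suc k)
    show ?case
      using bad_step(4)[OF Suc c L g] unfolding odd(2) e_def reversals.simps .
  qed
  note st = bad_step[OF bad c L g, folded e_def]
  have "legal n \<Delta> (dom (?run t)) (\<sigma> t)" for t
  proof (cases "even t")
    case True
    then obtain k where "t = 2 * k" by blast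
    then show ?thesis using st(1) s by metis
  next
    case False
    then obtain k where "t = Suc (2 * k)" by (metis oddE Suc_eq_plus1)
    then show ?thesis using st(2) s odd(1) by metis
  qed
  moreover have tot: "L * k \<le> total_recourse A \<chi> \<sigma> (2 * k)" for k
  proof (induction k)
    case 0
    then show ?case by simp
  next
    case (Suc k)
    have "L \<le> recourse (?run (2 * k)) (?run (Suc (2 * k)))"
      using st(3)[of k] unfolding odd(1) .
    then show ?case
      using Suc unfolding total_recourse_def by (simp del: run.simps)
  qed
  moreover have "total_recourse A \<chi> \<sigma> (2 * (T div 2)) \<le> total_recourse A \<chi> \<sigma> T" for T
    unfolding total_recourse_def by (intro sum_mono2) auto
  ultimately show ?thesis
    unfolding legal_sequence_def using order_trans by blast
qed

section \<open>The bad state and its reachability\<close>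

lemma grown_path:
  assumes D: "2 \<le> \<Delta>"
  shows "k < n \<Longrightarrow> \<exists>\<chi>. grown n \<Delta> (\<Delta> + c) \<chi> \<and> dom \<chi> = path_edges (\<lambda>i. i) k \<and>
    (\<forall>i<k. \<chi> {i, Suc i} = Some (alt i))"
proof (induction k)
  case 0
  show ?case
    by (intro exI[of _ Map.empty]) (simp add: grown.empty path_edges_def)
next
  case (Suc k)
  then obtain \<chi> where gr: "grown n \<Delta> (\<Delta> + c) \<chi>" and d: "dom \<chi> = path_edges (\<lambda>i. i) k"
    and q: "\<And>i. i < k \<Longrightarrow> \<chi> {i, Suc i} = Some (alt i)"
    by auto
  have f: "Suc k \<in> isolated n \<chi>"
    using Suc.prems unfolding isolated_def d path_edges_def by auto
  have ck: "cols \<chi> k \<subseteq> {alt (Suc k)}"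
  proof
    fix a assume "a \<in> cols \<chi> k"
    then obtain e where e: "\<chi> e = Some a" "k \<in> e" unfolding cols_def by blast
    then have "e \<in> path_edges (\<lambda>i. i) k" using d by blast
    then obtain i where i: "i < k" "e = {i, Suc i}" unfolding path_edges_def by auto
    then have "k = Suc i" using e(2) by auto
    then show "a \<in> {alt (Suc k)}" using q[OF i(1)] e(1) i(2) by (simp add: alt_def split: if_splits)
  qed
  then have "card (cols \<chi> k) \<le> 1"
    using card_mono[of "{alt (Suc k)}"] by fastforce
  moreover have "alt k \<notin> cols \<chi> k" using ck alt_Suc(2) by blast
  moreover have "alt k \<in> {1..\<Delta> + c}" using D unfolding alt_def by auto
  ultimately have "grown n \<Delta> (\<Delta> + c) (\<chi>({k, Suc k} \<mapsto> alt k))"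
    using Suc.prems D by (intro grown.pendant gr f) auto
  moreover have "dom (\<chi>({k, Suc k} \<mapsto> alt k)) = path_edges (\<lambda>i. i) (Suc k)"
    using d unfolding path_edges_def by (simp add: lessThan_Suc)
  moreover have "(\<chi>({k, Suc k} \<mapsto> alt k)) {i, Suc i} = Some (alt i)" if "i < Suc k" for i
  proof (cases "i = k")
    case False
    then have "{i, Suc i} \<noteq> {k, Suc k}" by (auto simp: doubleton_eq_iff)
    then show ?thesis using q[of i] that False by simp
  qed simp
  ultimately show ?case by blast
qed

text \<open>The path occupies the vertices up to \<open>L\<close> and \<open>v\<close> is
  \<open>Suc L\<close>, so the blocks start at \<open>L + 2\<close>. Block \<open>i\<close> is
  reserved for the trees at vertex \<open>i\<close>, including \<open>v\<close> for
  \<open>i = Suc L\<close>.\<close>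

definition block :: "nat \<Rightarrow> nat \<Rightarrow> nat \<Rightarrow> nat set" where
  "block L P i = {L + 2 + i * P..<L + 2 + Suc i * P}"

lemma block_disjoint: "i < j \<Longrightarrow> block L P i \<inter> block L P j = {}"
proof -
  assume "i < j"
  then have "Suc i * P \<le> j * P" by (intro mult_le_mono1) simp
  then show ?thesis unfolding block_def by auto
qed

lemma block_bound: "i \<le> j \<Longrightarrow> x \<in> block L P i \<Longrightarrow> L + 2 \<le> x \<and> x < L + 2 + Suc j * P"
proof -
  assume "i \<le> j" "x \<in> block L P i"
  moreover have "Suc i * P \<le> Suc j * P" using \<open>i \<le> j\<close> by (intro mult_le_mono1) simp
  ultimately show ?thesis unfolding block_def atLeastLessThan_iff by linarith
qed

lemma card_block: "card (block L P i) = P"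
  unfolding block_def by simp

text \<open>The induction records in which block each new edge lies: this keeps the next block
  isolated and leaves only path colors at the next path vertex. The colors 1 and 2 are disjoint from
  every side set.\<close>

lemma grown_sides:
  assumes c: "c + 2 \<le> \<Delta>" and n: "L + 2 + (L + 2) * \<Delta> ^ Suc L \<le> n"
    and gr0: "grown n \<Delta> (\<Delta> + c) \<chi>0" and d0: "dom \<chi>0 = path_edges (\<lambda>i. i) L"
    and q0: "\<forall>i<L. \<chi>0 {i, Suc i} = Some (alt i)"
  defines "P \<equiv> \<Delta> ^ Suc L"
  shows "j \<le> Suc L \<Longrightarrow> \<exists>\<chi>. grown n \<Delta> (\<Delta> + c) \<chi> \<and> \<chi>0 \<subseteq>\<^sub>m \<chi> \<and>
    (\<forall>e\<in>dom \<chi> - dom \<chi>0. \<exists>i<j. e \<subseteq> insert i (block L P i) \<and> (i \<in> e \<longrightarrow> \<chi> e \<in> Some ` side \<Delta> c i)) \<and>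
    (\<forall>i<j. \<forall>s\<in>side \<Delta> c i. guarded (\<Delta> + c) \<chi> i (block L P i) (insert (alt i) (side \<Delta> c i)) s L)"
proof (induction j)
  case 0
  then show ?case using gr0 by (intro exI[of _ \<chi>0]) simp
next
  case (Suc j)
  have D: "2 \<le> \<Delta>" using c by simp
  obtain \<chi> where gr: "grown n \<Delta> (\<Delta> + c) \<chi>" and le: "\<chi>0 \<subseteq>\<^sub>m \<chi>"
    and new: "\<forall>e\<in>dom \<chi> - dom \<chi>0. \<exists>i<j. e \<subseteq> insert i (block L P i) \<and> (i \<in> e \<longrightarrow> \<chi> e \<in> Some ` side \<Delta> c i)"
    and G: "\<forall>i<j. \<forall>s\<in>side \<Delta> c i. guarded (\<Delta> + c) \<chi> i (block L P i) (insert (alt i) (side \<Delta> c i)) s L"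
    using Suc.IH[OF Suc_leD[OF Suc.prems]] by (elim exE conjE)
  have jL: "j \<le> L" using Suc.prems by simp
  have sub0: "e \<subseteq> {..L}" if "e \<in> dom \<chi>0" for e
    using that unfolding d0 path_edges_def by auto
  have bl: "L + 2 \<le> x \<and> x < n" if "x \<in> block L P i" "i \<le> Suc L" for x i
    using block_bound[OF that(2,1)] n unfolding P_def by simp
  have fr: "block L P j \<subseteq> isolated n \<chi>"
  proof
    fix x assume x: "x \<in> block L P j"
    have "x \<notin> e" if e: "e \<in> dom \<chi>" for e
    proof (cases "e \<in> dom \<chi>0")
      case True
      then show ?thesis using sub0[OF True] bl[OF x] jL by fastforce
    next
      case False
      then obtain i where i: "i < j" "e \<subseteq> insert i (block L P i)" using new e by blast
      then show ?thesis
        using x bl[OF x] jL block_disjoint[OF i(1), of L P] by fastforce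
    qed
    then show "x \<in> isolated n \<chi>" using bl[OF x] jL unfolding isolated_def by simp
  qed
  have out: "j \<notin> block L P i" if "i \<le> L" for i
    using bl[of j i] that jL by auto
  have "cols \<chi> j = cols \<chi>0 j"
  proof (rule cols_extend[OF le])
    fix e assume "e \<in> dom \<chi> - dom \<chi>0"
    then obtain i where "i < j" "e \<subseteq> insert i (block L P i)" using new by blast
    then show "j \<notin> e" using out[of i] jL by auto
  qed
  also have "cols \<chi>0 j \<subseteq> {1, 2}"
  proof
    fix a assume "a \<in> cols \<chi>0 j"
    then obtain e where e: "\<chi>0 e = Some a" unfolding cols_def by blast
    then have "e \<in> path_edges (\<lambda>i. i) L" using d0 by blast
    then have "\<chi>0 e \<in> Some ` {1, 2}" using path_edge_colors[of L \<chi>0 "\<lambda>i. i"] q0 by blast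
    then show "a \<in> {1, 2}" using e by auto
  qed
  finally have cj: "cols \<chi> j \<subseteq> {1, 2}" .
  then have "card (cols \<chi> j) \<le> 2" using card_mono[of "{1, 2}" "cols \<chi> j"] by simp
  then have deg: "card (cols \<chi> j) + card (side \<Delta> c j) \<le> \<Delta>"
    using card_side(1)[OF D] D by simp
  have dj: "side \<Delta> c j \<inter> cols \<chi> j = {}"
    using cj unfolding side_def by (auto split: if_splits)
  have "(\<Delta> - 2) * \<Delta> ^ L \<le> \<Delta> * \<Delta> ^ L" by (intro mult_le_mono1) simp
  then have cS: "card (side \<Delta> c j) * \<Delta> ^ L \<le> card (block L P j)"
    unfolding card_block P_def card_side(1)[OF D] by simp
  have jn: "j < n" using jL n by simp
  obtain \<chi>' where gr': "grown n \<Delta> (\<Delta> + c) \<chi>'" and le': "\<chi> \<subseteq>\<^sub>m \<chi>'"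
    and new': "\<forall>e\<in>dom \<chi>' - dom \<chi>. e \<subseteq> insert j (block L P j) \<and> (j \<in> e \<longrightarrow> \<chi>' e \<in> Some ` side \<Delta> c j)"
    and G': "\<forall>b\<in>side \<Delta> c j. guarded (\<Delta> + c) \<chi>' j (block L P j) (insert (alt j) (side \<Delta> c j)) b L"
    using plant_guarded[OF plantable[OF refl c] refl c side_subset[OF D, of j] card_insert_side[OF D] jn
        card_side(2) subset_insertI gr out[OF jL] fr cS dj deg] by (elim exE conjE)
  have "\<exists>i<Suc j. e \<subseteq> insert i (block L P i) \<and> (i \<in> e \<longrightarrow> \<chi>' e \<in> Some ` side \<Delta> c i)"
    if e: "e \<in> dom \<chi>' - dom \<chi>0" for e
  proof (cases "e \<in> dom \<chi>")
    case True
    then have "e \<in> dom \<chi> - dom \<chi>0" using e by blast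
    then obtain i where "i < j" "e \<subseteq> insert i (block L P i)" "i \<in> e \<longrightarrow> \<chi> e \<in> Some ` side \<Delta> c i"
      by (rule new[THEN bspec, THEN exE]) (elim conjE)
    moreover have "\<chi>' e = \<chi> e" using le' True unfolding map_le_def by auto
    ultimately show ?thesis by (intro exI[of _ i]) simp
  next
    case False
    then have "e \<in> dom \<chi>' - dom \<chi>" using e by blast
    then show ?thesis using bspec[OF new'] by (intro exI[of _ j] conjI[OF lessI])
  qed
  moreover have "guarded (\<Delta> + c) \<chi>' i (block L P i) (insert (alt i) (side \<Delta> c i)) s L"
    if "i < Suc j" "s \<in> side \<Delta> c i" for i s
  proof (cases "i = j")
    case True
    then show ?thesis using G' that by blast
  next
    case False
    then show ?thesis using G that guarded_mono[OF _ le' subset_refl] by (metis less_antisym)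
  qed
  ultimately show ?case using gr' map_le_trans[OF le le'] by blast
qed

lemma bad_exists:
  assumes c: "c + 2 \<le> \<Delta>" and n: "L + 2 + (L + 2) * \<Delta> ^ Suc L \<le> n"
  shows "\<exists>\<chi> u v. grown n \<Delta> (\<Delta> + c) \<chi> \<and> bad n \<Delta> c L \<chi> u v \<and>
    n - (L + 2 + (L + 2) * \<Delta> ^ Suc L) \<le> card (isolated n \<chi>)"
proof -
  let ?P = "\<Delta> ^ Suc L" and ?v = "Suc L" and ?C0 = "insert (alt 0) (side \<Delta> c 0)"
  have D: "2 \<le> \<Delta>" using c by simp
  have Ln: "L < n" "?v < n" using n by auto
  obtain \<chi>0 where gr0: "grown n \<Delta> (\<Delta> + c) \<chi>0" and d0: "dom \<chi>0 = path_edges (\<lambda>i. i) L"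
    and q0: "\<forall>i<L. \<chi>0 {i, Suc i} = Some (alt i)"
    using grown_path[OF D Ln(1), of c] by (elim exE conjE)
  obtain \<chi>1 where gr1: "grown n \<Delta> (\<Delta> + c) \<chi>1" and le1: "\<chi>0 \<subseteq>\<^sub>m \<chi>1"
    and new1: "\<forall>e\<in>dom \<chi>1 - dom \<chi>0. \<exists>i<Suc L. e \<subseteq> insert i (block L ?P i) \<and>
      (i \<in> e \<longrightarrow> \<chi>1 e \<in> Some ` side \<Delta> c i)"
    and G1: "\<forall>i<Suc L. \<forall>s\<in>side \<Delta> c i.
      guarded (\<Delta> + c) \<chi>1 i (block L ?P i) (insert (alt i) (side \<Delta> c i)) s L"
    using grown_sides[OF c n gr0 d0 q0 order_refl] by (elim exE conjE)
  \<comment> \<open>The excluded color \<open>alt 0\<close> is 2, the color which the inserted edge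
    takes after the flip; it has to remain free at \<open>v\<close>.\<close>
  obtain C where C: "{1..\<Delta> + c} - ?C0 \<subseteq> C" "C \<subseteq> {1..\<Delta> + c}" "card C = \<Delta> - 1" "alt 0 \<notin> C"
    using obtain_color_set[OF refl c side_subset[OF D] card_insert_side[OF D] insertI1] .
  have sub0: "e \<subseteq> {..L}" if "e \<in> dom \<chi>0" for e
    using that unfolding d0 path_edges_def by auto
  have bl: "L + 2 \<le> x \<and> x < n" if "x \<in> block L ?P i" "i \<le> Suc L" for x i
    using block_bound[OF that(2,1)] n by simp
  let ?B = "block L ?P ?v"
  have sub1: "e \<inter> insert ?v ?B = {}" if e: "e \<in> dom \<chi>1" for e
  proof (cases "e \<in> dom \<chi>0")
    case True
    then show ?thesis using sub0[OF True] bl[of _ ?v] by fastforce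
  next
    case False
    then obtain i where i: "i < Suc L" "e \<subseteq> insert i (block L ?P i)" using new1 e by blast
    moreover have "i \<notin> ?B" "?v \<notin> block L ?P i" using bl[of i ?v] bl[of ?v i] i(1) by auto
    ultimately show ?thesis using block_disjoint[OF i(1), of L ?P] by auto
  qed
  have fr: "?B \<subseteq> isolated n \<chi>1" "?v \<in> isolated n \<chi>1"
    using sub1 bl[of _ ?v] Ln(2) unfolding isolated_def by auto
  have vB: "?v \<notin> ?B" using bl[of ?v ?v] by auto
  have cv: "cols \<chi>1 ?v = {}" using isolated_cols[OF fr(2)] .
  have cB: "\<Delta> ^ Suc L - 1 \<le> card ?B" by (simp add: card_block)
  obtain \<chi> where gr: "grown n \<Delta> (\<Delta> + c) \<chi>" and le: "\<chi>1 \<subseteq>\<^sub>m \<chi>"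
    and new: "\<forall>e\<in>dom \<chi> - dom \<chi>1. e \<subseteq> insert ?v ?B \<and> (?v \<in> e \<longrightarrow> \<chi> e \<in> Some ` C)"
    and co: "costly (\<Delta> + c) (\<chi> |` (dom \<chi> - dom \<chi>1)) ?v C (Suc L)"
    using plantable[OF refl c, of n "Suc L", unfolded plantable_def, rule_format, OF gr1 Ln(2) vB fr(1) cB C(2,3)]
      cv by auto
  have keep: "\<chi> e = \<chi>1 e" if "e \<in> dom \<chi>1" for e using le that unfolding map_le_def by simp
  have keep0: "\<chi> e = \<chi>0 e" if "e \<in> dom \<chi>0" for e
    using keep le1 that map_le_implies_dom_le[OF le1] unfolding map_le_def by (metis subsetD)
  have val: "valid_state n \<Delta> (\<Delta> + c) \<chi>" using grown_valid[OF gr] .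
  have cl: "closed_in (dom \<chi>) (insert ?v ?B)"
    unfolding closed_in_def using new sub1 by blast
  have uv: "i < n \<and> \<not> same_tree (dom \<chi>) i ?v" if i: "i \<le> L" for i
  proof -
    have "i \<notin> insert ?v ?B" using i bl[of i ?v] by auto
    then show ?thesis using closed_not_same_tree[OF cl] i Ln(1) by auto
  qed
  have q: "\<chi> {i, Suc i} = Some (alt i)" if "i < L" for i
    using keep0[of "{i, Suc i}"] q0 that by (metis domI)
  have sd: "\<chi> f \<in> Some ` side \<Delta> c i"
    if i: "i \<le> L" and f: "f \<in> dom \<chi>" "f \<notin> path_edges (\<lambda>i. i) L" "i \<in> f" for i f
  proof -
    have "i \<notin> insert ?v ?B" using i bl[of i ?v] by auto
    then have f1: "f \<in> dom \<chi>1" using new f by blast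
    have "f \<in> dom \<chi>1 - dom \<chi>0" using f1 f(2) d0 by blast
    then obtain k where k: "k < Suc L" "f \<subseteq> insert k (block L ?P k)" "k \<in> f \<longrightarrow> \<chi>1 f \<in> Some ` side \<Delta> c k"
      by (rule new1[THEN bspec, THEN exE]) (elim conjE)
    moreover have "i \<notin> block L ?P k" using bl[of i k] i k(1) by auto
    ultimately have "k = i" using f(3) by blast
    then show ?thesis using k(3) f(3) keep[OF f1] by simp
  qed
  have colv: "cols \<chi> ?v \<subseteq> C"
  proof
    fix a assume "a \<in> cols \<chi> ?v"
    then obtain e where e: "\<chi> e = Some a" "?v \<in> e" unfolding cols_def by blast
    then have "e \<in> dom \<chi> - dom \<chi>1" using sub1 by blast
    then have "\<chi> e \<in> Some ` C" using new e(2) by blast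
    then show "a \<in> C" using e(1) by auto
  qed
  have "finite C" using C(2) finite_subset by auto
  then have cdeg: "card (cols \<chi> ?v) < \<Delta>"
    using card_mono[OF _ colv] C(3) D by linarith
  have two: "2 \<notin> cols \<chi> ?v" using colv C(4) by (auto simp: alt_def)
  have gd: "\<exists>S. S \<inter> (\<lambda>i. i) ` {..L} = {} \<and> guarded (\<Delta> + c) \<chi> i S (insert (alt i) (side \<Delta> c i)) s L"
    if i: "i \<le> L" and s: "s \<in> side \<Delta> c i" for i s
  proof (intro exI conjI)
    show "block L ?P i \<inter> (\<lambda>i. i) ` {..L} = {}" using bl[of _ i] i by fastforce
    have "guarded (\<Delta> + c) \<chi>1 i (block L ?P i) (insert (alt i) (side \<Delta> c i)) s L"
      using G1 i s by (simp add: less_Suc_eq_le)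
    then show "guarded (\<Delta> + c) \<chi> i (block L ?P i) (insert (alt i) (side \<Delta> c i)) s L"
      using guarded_mono[OF _ le subset_refl] by blast
  qed
  let ?\<psi> = "\<chi> |` (dom \<chi> - dom \<chi>1)"
  have "?\<psi> \<subseteq>\<^sub>m \<chi>" unfolding map_le_def by auto
  moreover have "dom ?\<psi> \<inter> path_edges (\<lambda>i. i) L = {}"
    using map_le_implies_dom_le[OF le1] d0 unfolding dom_restrict by blast
  ultimately have vx: "\<exists>\<psi> C. \<psi> \<subseteq>\<^sub>m \<chi> \<and> dom \<psi> \<inter> path_edges (\<lambda>i. i) L = {} \<and>
      {1..\<Delta> + c} - ?C0 \<subseteq> C \<and> costly (\<Delta> + c) \<psi> ?v C (Suc L)"
    using C(1) co by blast
  have bad: "bad n \<Delta> c L \<chi> (\<lambda>i. i) ?v"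
    unfolding bad_def using val uv q sd cdeg two gd vx Ln(2)
    by (intro conjI allI impI ballI) auto
  let ?m = "L + 2 + (L + 2) * ?P"
  have "{?m..<n} \<subseteq> isolated n \<chi>"
  proof
    fix x assume x: "x \<in> {?m..<n}"
    have bm: "x \<notin> block L ?P i" if "i \<le> ?v" for i
      using block_bound[OF that, of x L ?P] x by auto
    have xL: "?v < x" using x by auto
    have "x \<notin> e" if e: "e \<in> dom \<chi>" for e
    proof -
      consider "e \<in> dom \<chi>0" | "e \<in> dom \<chi>1 - dom \<chi>0" | "e \<in> dom \<chi> - dom \<chi>1" using e by blast
      then show ?thesis
      proof cases
        case 1
        then show ?thesis using sub0 xL by fastforce
      next
        case 2
        then obtain i where "i < Suc L" "e \<subseteq> insert i (block L ?P i)" using new1 by blast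
        then show ?thesis using bm[of i] xL by auto
      next
        case 3
        then have "e \<subseteq> insert ?v ?B" using new by blast
        then show ?thesis using bm[of ?v] xL by auto
      qed
    qed
    then show "x \<in> isolated n \<chi>" using x unfolding isolated_def by simp
  qed
  then have "card {?m..<n} \<le> card (isolated n \<chi>)"
    by (rule card_mono[OF finite_isolated])
  then have "n - ?m \<le> card (isolated n \<chi>)" by (simp only: card_atLeastLessThan)
  then show ?thesis using gr bad by blast
qed

text \<open>The linear factor is absorbed by
  \<open>2 * (L + 2) \<le> 3 ^ (L + 2) \<le> \<Delta> ^ (L + 2)\<close>, and the factor 3 by one
  further power of \<open>\<Delta>\<close>. The factor 3 is there to leave two thirds of the
  vertices isolated.\<close>

lemma power_bound:
  assumes "3 \<le> (\<Delta>::nat)"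
  shows "3 * (L + 2 + (L + 2) * \<Delta> ^ Suc L) \<le> \<Delta> ^ (2 * L + 5)"
proof -
  have k: "2 * (k + 2) \<le> 3 ^ (k + 2)" for k :: nat by (induction k) auto
  have "(L + 2) * 1 \<le> (L + 2) * \<Delta> ^ Suc L"
    using assms by (intro mult_le_mono2) simp
  then have "L + 2 + (L + 2) * \<Delta> ^ Suc L \<le> 2 * (L + 2) * \<Delta> ^ Suc L" by simp
  also have "\<dots> \<le> 3 ^ (L + 2) * \<Delta> ^ Suc L" using k by (intro mult_le_mono1)
  also have "\<dots> \<le> \<Delta> ^ (L + 2) * \<Delta> ^ Suc L" using assms by (intro mult_le_mono1 power_mono) auto
  also have "\<dots> \<le> \<Delta> ^ (2 * L + 4)"
    unfolding power_add[symmetric] using assms by (intro power_increasing) auto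
  finally have "3 * (L + 2 + (L + 2) * \<Delta> ^ Suc L) \<le> \<Delta> * \<Delta> ^ (2 * L + 4)"
    using assms by (intro mult_le_mono)
  then show ?thesis by (simp add: numeral_eq_Suc)
qed

theorem theorem2p5:
  "\<exists>C::real. C > 0 \<and> (\<exists>K::real. \<forall>\<Delta> c :: nat. 3 \<le> \<Delta> \<and> c \<le> \<Delta> - 2 \<longrightarrow>
     (\<exists>n1::nat. \<forall>n::nat. K \<le> log (real \<Delta>) (real n) \<longrightarrow>
       (\<forall>A. greedy_rule n \<Delta> (\<Delta> + c) A \<longrightarrow>
         (\<exists>\<chi>. valid_state n \<Delta> (\<Delta> + c) \<chi> \<and>
           (\<exists>\<sigma>. legal_sequence n \<Delta> A \<chi> \<sigma> \<and>
             ereal (C * log (real \<Delta>) (real n)) \<le> amortized_recourse A \<chi> \<sigma>) \<and>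
           (n1 \<le> n \<longrightarrow> reachable n \<Delta> A \<chi>)))))"
proof -
  have main: "\<exists>n1. \<forall>n. 18 \<le> log (real \<Delta>) (real n) \<longrightarrow> (\<forall>A. greedy_rule n \<Delta> (\<Delta> + c) A \<longrightarrow>
      (\<exists>\<chi>. valid_state n \<Delta> (\<Delta> + c) \<chi> \<and>
        (\<exists>\<sigma>. legal_sequence n \<Delta> A \<chi> \<sigma> \<and>
          ereal (1 / 16 * log (real \<Delta>) (real n)) \<le> amortized_recourse A \<chi> \<sigma>) \<and>
        (n1 \<le> n \<longrightarrow> reachable n \<Delta> A \<chi>)))"
    if D: "3 \<le> \<Delta> \<and> c \<le> \<Delta> - 2" for \<Delta> c
  proof -
    have c: "c + 2 \<le> \<Delta>" "c < \<Delta>" using D by auto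
    obtain M where M: "\<And>n A \<chi>. greedy_rule n \<Delta> (\<Delta> + c) A \<Longrightarrow> grown n \<Delta> (\<Delta> + c) \<chi> \<Longrightarrow>
      M \<le> card (isolated n \<chi>) \<Longrightarrow> reachable n \<Delta> A \<chi>"
      using grown_reachable[OF c(2)] by blast
    show ?thesis
    proof (intro exI[of _ "2 * M"] allI impI)
      fix n A
      assume ln: "18 \<le> log (real \<Delta>) (real n)" and g: "greedy_rule n \<Delta> (\<Delta> + c) A"
      define l where "l = log (real \<Delta>) (real n)"
      \<comment> \<open>With \<open>L = 2 * j\<close>, which makes \<open>L\<close> even,
        \<open>4 * j + 5 \<le> l\<close> is the condition \<open>2 * L + 5 \<le> l\<close> required
        by \<open>power_bound\<close>.\<close>
      define j where "j = nat \<lfloor>(l - 5) / 4\<rfloor>"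
      define L where "L = 2 * j"
      \<comment> \<open>\<open>log\<close> has the value 0 at 0, so the lower bound on the logarithm
        excludes \<open>n = 0\<close>.\<close>
      have n0: "0 < n" using ln by (cases "n = 0") (auto simp: log_def)
      have "0 \<le> (l - 5) / 4" using ln unfolding l_def by simp
      then have "real j = of_int \<lfloor>(l - 5) / 4\<rfloor>" unfolding j_def by simp
      then have "real j \<le> (l - 5) / 4" "(l - 5) / 4 < real j + 1"
        using of_int_floor_le floor_less_iff by (metis, linarith)
      \<comment> \<open>The floor gives \<open>j > (l - 9) / 4\<close>, and this is at least
        \<open>l / 8\<close> exactly when \<open>l \<ge> 18\<close>; this is the origin of
        18.\<close>
      then have j: "real (2 * L + 5) \<le> l" "l / 8 \<le> real j" "1 \<le> j"
        using ln unfolding L_def l_def by auto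
      have "real \<Delta> powr real (2 * L + 5) \<le> real \<Delta> powr l"
        using j(1) D by (intro powr_mono) auto
      also have "\<dots> = real n" unfolding l_def using D n0 by simp
      finally have "real (\<Delta> ^ (2 * L + 5)) \<le> real n"
        using D by (simp add: powr_realpow del: of_nat_add of_nat_mult)
      then have "\<Delta> ^ (2 * L + 5) \<le> n" by (simp only: of_nat_le_iff)
      define m where "m = L + 2 + (L + 2) * \<Delta> ^ Suc L"
      have n3: "3 * m \<le> n"
        using power_bound[OF conjunct1[OF D], of L] \<open>\<Delta> ^ (2 * L + 5) \<le> n\<close> unfolding m_def
        by (rule order_trans)
      then have n1: "L + 2 + (L + 2) * \<Delta> ^ Suc L \<le> n" unfolding m_def[symmetric] by linarith
      obtain \<chi> u v where gr: "grown n \<Delta> (\<Delta> + c) \<chi>" and B: "bad n \<Delta> c L \<chi> u v"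
        and fr: "n - m \<le> card (isolated n \<chi>)"
        using bad_exists[OF c(1) n1] unfolding m_def by (elim exE conjE)
      have L0: "0 < L" "even L" using j(3) unfolding L_def by auto
      obtain \<sigma> where leg: "legal_sequence n \<Delta> A \<chi> \<sigma>"
        and tot: "\<And>T. L * (T div 2) \<le> total_recourse A \<chi> \<sigma> T"
        using bad_sequence[OF B c(1) L0 g] by blast
      have "ereal (real j / 2) \<le> amortized_recourse A \<chi> \<sigma>"
        unfolding amortized_recourse_def
      proof (rule Liminf_bounded)
        show "\<forall>\<^sub>F T in sequentially. ereal (real j / 2) \<le> ereal (real (total_recourse A \<chi> \<sigma> T) / real T)"
          using eventually_ge_at_top[of 2]
        proof eventually_elim
          case (elim T)
          \<comment> \<open>Rounding in \<open>T div 2\<close> costs at most a factor 2 once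
            \<open>T \<ge> 2\<close>. So \<open>2 * j\<close> changes per pair of updates give the
            average \<open>j / 2\<close>, and \<open>j \<ge> l / 8\<close> yields the constant
            1/16.\<close>
          have "T \<le> 4 * (T div 2)" using elim by linarith
          then have "j * T \<le> j * (4 * (T div 2))" by (rule mult_le_mono2)
          also have "\<dots> = 2 * (L * (T div 2))" unfolding L_def by simp
          also have "\<dots> \<le> 2 * total_recourse A \<chi> \<sigma> T" using tot by simp
          finally have "real j * real T \<le> 2 * real (total_recourse A \<chi> \<sigma> T)"
            by (metis of_nat_le_iff of_nat_mult of_nat_numeral)
          then show ?case using elim by (simp add: field_simps)
        qed
      qed
      moreover have "1 / 16 * l \<le> real j / 2" using j(2) by simp
      ultimately have "ereal (1 / 16 * l) \<le> amortized_recourse A \<chi> \<sigma>"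
        by (meson ereal_less_eq(3) order_trans)
      \<comment> \<open>At least \<open>2 * n / 3\<close> vertices are isolated, which is at least
        \<open>M\<close> as soon as \<open>n \<ge> 2 * M\<close>.\<close>
      moreover have "reachable n \<Delta> A \<chi>" if "2 * M \<le> n"
        using M[OF g gr] fr n3 that by linarith
      ultimately show "\<exists>\<chi>. valid_state n \<Delta> (\<Delta> + c) \<chi> \<and>
        (\<exists>\<sigma>. legal_sequence n \<Delta> A \<chi> \<sigma> \<and>
          ereal (1 / 16 * log (real \<Delta>) (real n)) \<le> amortized_recourse A \<chi> \<sigma>) \<and>
        (2 * M \<le> n \<longrightarrow> reachable n \<Delta> A \<chi>)"
        using grown_valid[OF gr] leg unfolding l_def by blast
    qed
  qed
  show ?thesis
    by (rule exI[of _ "1 / 16"], rule conjI, simp, rule exI[of _ 18]) (intro allI impI main)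
qed

end
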